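(* Let $M$ be an invariant submanifold of a generalized Sasakian-space-form $\overline{M}^{2n+1}(f_1,f_2,f_3)$ with $f_1\neq f_3$ at every point. Then $M$ is totally geodesic if and only if $M$ is $2$-semiparallel.
   Context: An almost contact metric manifold $(\overline M,\phi,\xi,\eta,g)$ is a Riemannian manifold $(\overline M,g)$ with a $(1,1)$-tensor field $\phi$, a vector field $\xi$ and a $1$-form $\eta$ such that $\phi^2X=-X+\eta(X)\xi$, $\phi\xi=0$, $\eta(\xi)=1$, $g(X,\xi)=\eta(X)$, $\eta(\phi X)=0$, $g(\phi X,\phi Y)=g(X,Y)-\eta(X)\eta(Y)$. Curvature convention: $R(X,Y)=[\nabla_X,\nabla_Y]-\nabla_{[X,Y]}$. A generalized Sasakian-space-form $\overline M^{2n+1}(f_1,f_2,f_3)$ is an almost contact metric manifold of dimension $2n+1$, $n>1$, with smooth functions $f_1,f_2,f_3$ on $\overline M$ such that the curvature tensor $\overline R$ of its Levi-Civita connection $\overline\nabla$ satisfies $\overline R(X,Y)Z=f_1\{g(Y,Z)X-g(X,Z)Y\}+f_2\{g(X,\phi Z)\phi Y-g(Y,\phi Z)\phi X+2g(X,\phi Y)\phi Z\}+f_3\{\eta(X)\eta(Z)Y-\eta(Y)\eta(Z)X+g(X,Z)\eta(Y)\xi-g(Y,Z)\eta(X)\xi\}.$ Throughout, the following structure equations also hold on $\overline M$: $(\overline\nabla_X\phi)(Y)=(f_1-f_3)[g(X,Y)\xi-\eta(Y)X]$ and $\overline\nabla_X\xi=-(f_1-f_3)\phi X$. A submanifold $M$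 of $\overline M$ is invariant if $\xi$ is tangent to $M$ and $\phi(TM)\subset TM$ at every point of $M$. $M$ carries the induced metric and Levi-Civita connection $\nabla$ with curvature tensor $R$, the normal connection $\nabla^\perp$ with curvature $R^\perp(X,Y)=[\nabla^\perp_X,\nabla^\perp_Y]-\nabla^\perp_{[X,Y]}$, and the second fundamental form $h$, with $\overline\nabla_XY=\nabla_XY+h(X,Y)$. $M$ is totally geodesic if $h=0$. Write $(\overline\nabla h)(Z,U,W)=(\overline\nabla_Zh)(U,W)=\nabla^\perp_Z(h(U,W))-h(\nabla_ZU,W)-h(U,\nabla_ZW)$. $M$ is $2$-semiparallel if, for all $X,Y,Z,U,W$ tangent to $M$, $(\overline R(X,Y)\cdot\overline\nabla h)(Z,U,W):=R^\perp(X,Y)(\overline\nabla h)(Z,U,W)-(\overline\nabla h)(R(X,Y)Z,U,W)-(\overline\nabla h)(Z,R(X,Y)U,W)-(\overline\nabla h)(Z,U,R(X,Y)W)=0$. *)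

theory Defs
  imports "HOL-Analysis.Analysis" "HOL-Library.Function_Algebras"
begin

text \<open>
  Conventions. A smooth manifold is a type of class \<open>t2_space\<close> and
  \<open>second_countable_topology\<close> together with a smooth atlas modelled on a Euclidean space.
  Tangent vectors at a point are derivations of the algebra of globally defined smooth functions;
  vector fields, metrics, tensor fields and connections are given on global vector fields.
  The submanifold \<open>M\<close> is a manifold (type \<open>'b\<close>, atlas \<open>A\<close>) with an immersion
  \<open>i\<close> into the ambient manifold (type \<open>'a\<close>, atlas \<open>B\<close>), and \<open>T M\<close> is viewed inside the
  ambient tangent bundle through the differential of \<open>i\<close>.
\<close>

instantiation "fun" :: (type, real_vector) real_vector
begin

definition scaleR_fun :: "real \<Rightarrow> ('a \<Rightarrow> 'b) \<Rightarrow> 'a \<Rightarrow> 'b" where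
  "scaleR_fun c f = (\<lambda>x. c *\<^sub>R f x)"

instance
  by standard (auto simp: scaleR_fun_def fun_eq_iff algebra_simps)

end


section \<open>Smooth manifolds\<close>

text \<open>The set \<open>S\<close> is meant to be open.\<close>

primrec Ck_on :: "nat \<Rightarrow> 'e::real_normed_vector set \<Rightarrow> ('e \<Rightarrow> 'f::real_normed_vector) \<Rightarrow> bool" where
  "Ck_on 0 S f \<longleftrightarrow> continuous_on S f"
| "Ck_on (Suc k) S f \<longleftrightarrow>
     f differentiable_on S \<and> (\<forall>v. Ck_on k S (\<lambda>x. frechet_derivative f (at x) v))"

definition smooth_on :: "'e::real_normed_vector set \<Rightarrow> ('e \<Rightarrow> 'f::real_normed_vector) \<Rightarrow> bool" where
  "smooth_on S f \<longleftrightarrow> (\<forall>k. Ck_on k S f)"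

type_synonym ('a, 'e) atlas = "('a set \<times> ('a \<Rightarrow> 'e)) set"

definition smooth_atlas ::
  "('a::{t2_space,second_countable_topology}, 'e::euclidean_space) atlas \<Rightarrow> bool" where
  "smooth_atlas A \<longleftrightarrow>
     (\<Union>(U, c)\<in>A. U) = UNIV \<and>
     (\<forall>(U, c)\<in>A. open U \<and> open (c ` U) \<and> homeomorphism U (c ` U) c (inv_into U c)) \<and>
     (\<forall>(U, c)\<in>A. \<forall>(V, d)\<in>A. smooth_on (c ` (U \<inter> V)) (d \<circ> inv_into U c))"

definition smooth_functions :: "('a, 'e::euclidean_space) atlas \<Rightarrow> ('a \<Rightarrow> real) set" where
  "smooth_functions A = {f. \<forall>(U, c)\<in>A. smooth_on (c ` U) (f \<circ> inv_into U c)}"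

definition smooth_map ::
  "('b::topological_space, 'f::euclidean_space) atlas \<Rightarrow>
   ('a::topological_space, 'e::euclidean_space) atlas \<Rightarrow> ('b \<Rightarrow> 'a) \<Rightarrow> bool" where
  "smooth_map A B i \<longleftrightarrow> continuous_on UNIV i \<and>
     (\<forall>(U, c)\<in>A. \<forall>(V, d)\<in>B. smooth_on (c ` (U \<inter> i -` V)) (d \<circ> i \<circ> inv_into U c))"

type_synonym 'a tvec = "('a \<Rightarrow> real) \<Rightarrow> real"

text \<open>A derivation is normalised to be \<open>0\<close> on functions which are not smooth, so that equality of
  tangent vectors is equality in \<open>'a tvec\<close>.\<close>

definition tangent_space :: "('a, 'e::euclidean_space) atlas \<Rightarrow> 'a \<Rightarrow> 'a tvec set" where
  "tangent_space A p = {v.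
     (\<forall>f\<in>smooth_functions A. \<forall>g\<in>smooth_functions A. v (f + g) = v f + v g) \<and>
     (\<forall>f\<in>smooth_functions A. \<forall>c. v (c *\<^sub>R f) = c * v f) \<and>
     (\<forall>f\<in>smooth_functions A. \<forall>g\<in>smooth_functions A. v (f * g) = f p * v g + g p * v f) \<and>
     (\<forall>f. f \<notin> smooth_functions A \<longrightarrow> v f = 0)}"

definition differential ::
  "('a, 'e::euclidean_space) atlas \<Rightarrow> ('b \<Rightarrow> 'a) \<Rightarrow> 'b tvec \<Rightarrow> 'a tvec" where
  "differential B i v = (\<lambda>f. if f \<in> smooth_functions B then v (f \<circ> i) else 0)"

definition immersion ::
  "('b::topological_space, 'f::euclidean_space) atlas \<Rightarrow>
   ('a::topological_space, 'e::euclidean_space) atlas \<Rightarrow> ('b \<Rightarrow> 'a) \<Rightarrow> bool" where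
  "immersion A B i \<longleftrightarrow> smooth_map A B i \<and>
     (\<forall>p. inj_on (differential B i) (tangent_space A p))"

text \<open>Smooth sections of the pulled back tangent bundle (vector fields along \<open>i\<close>).\<close>

definition sections_along ::
  "('b, 'f::euclidean_space) atlas \<Rightarrow> ('a, 'e::euclidean_space) atlas \<Rightarrow> ('b \<Rightarrow> 'a) \<Rightarrow>
   ('b \<Rightarrow> 'a tvec) set" where
  "sections_along A B i = {V. (\<forall>p. V p \<in> tangent_space B (i p)) \<and>
     (\<forall>f\<in>smooth_functions B. (\<lambda>p. V p f) \<in> smooth_functions A)}"

definition vector_fields :: "('a, 'e::euclidean_space) atlas \<Rightarrow> ('a \<Rightarrow> 'a tvec) set" where
  "vector_fields A = sections_along A A (\<lambda>p. p)"

definition lie_bracket :: "('a \<Rightarrow> 'a tvec) \<Rightarrow> ('a \<Rightarrow> 'a tvec) \<Rightarrow> 'a \<Rightarrow> 'a tvec" where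
  "lie_bracket X Y = (\<lambda>p f. X p (\<lambda>q. Y q f) - Y p (\<lambda>q. X q f))"


section \<open>Metrics and connections\<close>

type_synonym 'a metric = "'a \<Rightarrow> 'a tvec \<Rightarrow> 'a tvec \<Rightarrow> real"

definition riemannian_metric :: "('a, 'e::euclidean_space) atlas \<Rightarrow> 'a metric \<Rightarrow> bool" where
  "riemannian_metric A g \<longleftrightarrow>
     (\<forall>p. \<forall>u\<in>tangent_space A p. \<forall>v\<in>tangent_space A p.
        g p u v = g p v u \<and> (u \<noteq> 0 \<longrightarrow> g p u u > 0) \<and>
        (\<forall>w\<in>tangent_space A p. g p (u + v) w = g p u w + g p v w) \<and>
        (\<forall>c. g p (c *\<^sub>R u) v = c * g p u v)) \<and>
     (\<forall>X\<in>vector_fields A. \<forall>Y\<in>vector_fields A. (\<lambda>p. g p (X p) (Y p)) \<in> smooth_functions A)"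

text \<open>\<open>D p v V\<close> is the derivative at \<open>p\<close> of the section \<open>V\<close> in the direction of the
  tangent vector \<open>v\<close>.\<close>

type_synonym ('b, 's) connection = "'b \<Rightarrow> 'b tvec \<Rightarrow> ('b \<Rightarrow> 's) \<Rightarrow> 's"

definition cov ::
  "('b, 's) connection \<Rightarrow> ('b \<Rightarrow> 'b tvec) \<Rightarrow> ('b \<Rightarrow> 's) \<Rightarrow> 'b \<Rightarrow> 's" where
  "cov D X V = (\<lambda>p. D p (X p) V)"

definition curvature ::
  "('b, 's::real_vector) connection \<Rightarrow> ('b \<Rightarrow> 'b tvec) \<Rightarrow> ('b \<Rightarrow> 'b tvec) \<Rightarrow> ('b \<Rightarrow> 's) \<Rightarrow> 'b \<Rightarrow> 's" where
  "curvature D X Y V = cov D X (cov D Y V) - cov D Y (cov D X V) - cov D (lie_bracket X Y) V"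

definition connection_along ::
  "('b, 'f::euclidean_space) atlas \<Rightarrow> ('a, 'e::euclidean_space) atlas \<Rightarrow> ('b \<Rightarrow> 'a) \<Rightarrow>
   ('b, 'a tvec) connection \<Rightarrow> bool" where
  "connection_along A B i D \<longleftrightarrow>
     (\<forall>p. \<forall>u\<in>tangent_space A p. \<forall>V\<in>sections_along A B i.
        D p u V \<in> tangent_space B (i p) \<and>
        (\<forall>v\<in>tangent_space A p. D p (u + v) V = D p u V + D p v V) \<and>
        (\<forall>c. D p (c *\<^sub>R u) V = c *\<^sub>R D p u V) \<and>
        (\<forall>W\<in>sections_along A B i. D p u (V + W) = D p u V + D p u W) \<and>
        (\<forall>f\<in>smooth_functions A. D p u (\<lambda>q. f q *\<^sub>R V q) = u f *\<^sub>R V p + f p *\<^sub>R D p u V)) \<and>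
     (\<forall>X\<in>vector_fields A. \<forall>V\<in>sections_along A B i. cov D X V \<in> sections_along A B i)"

definition levi_civita ::
  "('a, 'e::euclidean_space) atlas \<Rightarrow> 'a metric \<Rightarrow> ('a, 'a tvec) connection \<Rightarrow> bool" where
  "levi_civita A g nab \<longleftrightarrow>
     connection_along A A (\<lambda>p. p) nab \<and>
     (\<forall>X\<in>vector_fields A. \<forall>Y\<in>vector_fields A. cov nab X Y - cov nab Y X = lie_bracket X Y) \<and>
     (\<forall>X\<in>vector_fields A. \<forall>Y\<in>vector_fields A. \<forall>Z\<in>vector_fields A. \<forall>p.
        X p (\<lambda>q. g q (Y q) (Z q)) = g p (cov nab X Y p) (Z p) + g p (Y p) (cov nab X Z p))"


section \<open>Generalized Sasakian-space-forms\<close>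

definition almost_contact_metric ::
  "('a, 'e::euclidean_space) atlas \<Rightarrow> 'a metric \<Rightarrow> ('a \<Rightarrow> 'a tvec \<Rightarrow> 'a tvec) \<Rightarrow>
   ('a \<Rightarrow> 'a tvec) \<Rightarrow> ('a \<Rightarrow> 'a tvec \<Rightarrow> real) \<Rightarrow> bool" where
  "almost_contact_metric B g \<phi> \<xi> \<eta> \<longleftrightarrow>
     riemannian_metric B g \<and>
     (\<forall>p. \<forall>u\<in>tangent_space B p. \<phi> p u \<in> tangent_space B p \<and>
        (\<forall>v\<in>tangent_space B p. \<phi> p (u + v) = \<phi> p u + \<phi> p v \<and> \<eta> p (u + v) = \<eta> p u + \<eta> p v) \<and>
        (\<forall>c. \<phi> p (c *\<^sub>R u) = c *\<^sub>R \<phi> p u \<and> \<eta> p (c *\<^sub>R u) = c * \<eta> p u)) \<and>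
     (\<forall>X\<in>vector_fields B. (\<lambda>p. \<phi> p (X p)) \<in> vector_fields B \<and>
        (\<lambda>p. \<eta> p (X p)) \<in> smooth_functions B) \<and>
     \<xi> \<in> vector_fields B \<and>
     (\<forall>p. \<phi> p (\<xi> p) = 0 \<and> \<eta> p (\<xi> p) = 1 \<and>
        (\<forall>u\<in>tangent_space B p.
           \<phi> p (\<phi> p u) = - u + \<eta> p u *\<^sub>R \<xi> p \<and>
           g p u (\<xi> p) = \<eta> p u \<and>
           \<eta> p (\<phi> p u) = 0 \<and>
           (\<forall>v\<in>tangent_space B p. g p (\<phi> p u) (\<phi> p v) = g p u v - \<eta> p u * \<eta> p v)))"

definition generalized_sasakian_space_form ::
  "nat \<Rightarrow> ('a::{t2_space,second_countable_topology}, 'e::euclidean_space) atlas \<Rightarrow> 'a metric \<Rightarrow>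
   ('a \<Rightarrow> 'a tvec \<Rightarrow> 'a tvec) \<Rightarrow> ('a \<Rightarrow> 'a tvec) \<Rightarrow> ('a \<Rightarrow> 'a tvec \<Rightarrow> real) \<Rightarrow>
   ('a \<Rightarrow> real) \<Rightarrow> ('a \<Rightarrow> real) \<Rightarrow> ('a \<Rightarrow> real) \<Rightarrow> ('a, 'a tvec) connection \<Rightarrow> bool" where
  "generalized_sasakian_space_form n B g \<phi> \<xi> \<eta> f1 f2 f3 nab \<longleftrightarrow>
     DIM('e) = 2 * n + 1 \<and> n > 1 \<and> smooth_atlas B \<and>
     almost_contact_metric B g \<phi> \<xi> \<eta> \<and>
     f1 \<in> smooth_functions B \<and> f2 \<in> smooth_functions B \<and> f3 \<in> smooth_functions B \<and>
     levi_civita B g nab \<and>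
     (\<forall>X\<in>vector_fields B. \<forall>Y\<in>vector_fields B. \<forall>Z\<in>vector_fields B. \<forall>p.
        curvature nab X Y Z p =
          f1 p *\<^sub>R (g p (Y p) (Z p) *\<^sub>R X p - g p (X p) (Z p) *\<^sub>R Y p) +
          f2 p *\<^sub>R (g p (X p) (\<phi> p (Z p)) *\<^sub>R \<phi> p (Y p) - g p (Y p) (\<phi> p (Z p)) *\<^sub>R \<phi> p (X p)
                  + (2 * g p (X p) (\<phi> p (Y p))) *\<^sub>R \<phi> p (Z p)) +
          f3 p *\<^sub>R ((\<eta> p (X p) * \<eta> p (Z p)) *\<^sub>R Y p - (\<eta> p (Y p) * \<eta> p (Z p)) *\<^sub>R X p
                  + (g p (X p) (Z p) * \<eta> p (Y p)) *\<^sub>R \<xi> p - (g p (Y p) (Z p) * \<eta> p (X p)) *\<^sub>R \<xi> p))"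

text \<open>The covariant derivative of \<open>\<phi>\<close> is
  \<open>(\<nabla>\<^sub>X \<phi>) Y = \<nabla>\<^sub>X (\<phi> Y) - \<phi> (\<nabla>\<^sub>X Y)\<close>.\<close>

definition structure_equations ::
  "('a, 'e::euclidean_space) atlas \<Rightarrow> 'a metric \<Rightarrow>
   ('a \<Rightarrow> 'a tvec \<Rightarrow> 'a tvec) \<Rightarrow> ('a \<Rightarrow> 'a tvec) \<Rightarrow> ('a \<Rightarrow> 'a tvec \<Rightarrow> real) \<Rightarrow>
   ('a \<Rightarrow> real) \<Rightarrow> ('a \<Rightarrow> real) \<Rightarrow> ('a, 'a tvec) connection \<Rightarrow> bool" where
  "structure_equations B g \<phi> \<xi> \<eta> f1 f3 nab \<longleftrightarrow>
     (\<forall>X\<in>vector_fields B. \<forall>Y\<in>vector_fields B. \<forall>p.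
        cov nab X (\<lambda>q. \<phi> q (Y q)) p - \<phi> p (cov nab X Y p) =
          (f1 p - f3 p) *\<^sub>R (g p (X p) (Y p) *\<^sub>R \<xi> p - \<eta> p (Y p) *\<^sub>R X p)) \<and>
     (\<forall>X\<in>vector_fields B. \<forall>p. cov nab X \<xi> p = - (f1 p - f3 p) *\<^sub>R \<phi> p (X p))"


section \<open>Geometry of submanifolds\<close>

definition invariant_submanifold ::
  "('b::{t2_space,second_countable_topology}, 'f::euclidean_space) atlas \<Rightarrow>
   ('a::{t2_space,second_countable_topology}, 'e::euclidean_space) atlas \<Rightarrow> ('b \<Rightarrow> 'a) \<Rightarrow>
   ('a \<Rightarrow> 'a tvec \<Rightarrow> 'a tvec) \<Rightarrow> ('a \<Rightarrow> 'a tvec) \<Rightarrow> bool" where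
  "invariant_submanifold A B i \<phi> \<xi> \<longleftrightarrow>
     smooth_atlas A \<and> immersion A B i \<and>
     (\<forall>p. \<xi> (i p) \<in> differential B i ` tangent_space A p \<and>
        \<phi> (i p) ` differential B i ` tangent_space A p \<subseteq> differential B i ` tangent_space A p)"

definition induced_metric ::
  "('a, 'e::euclidean_space) atlas \<Rightarrow> ('b \<Rightarrow> 'a) \<Rightarrow> 'a metric \<Rightarrow> 'b metric" where
  "induced_metric B i g = (\<lambda>p u v. g (i p) (differential B i u) (differential B i v))"

text \<open>The ambient connection along \<open>M\<close>, i.e. the unique connection on the pulled back tangent
  bundle that is given by \<open>nab\<close> on restrictions of ambient vector fields. It gives a meaning to
  \<open>\<nabla>\<^sub>X V\<close> for \<open>X\<close> tangent to \<open>M\<close> and \<open>V\<close> only defined along \<open>M\<close>.\<close>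

definition pullback_connection ::
  "('b, 'f::euclidean_space) atlas \<Rightarrow> ('a, 'e::euclidean_space) atlas \<Rightarrow> ('b \<Rightarrow> 'a) \<Rightarrow>
   ('a, 'a tvec) connection \<Rightarrow> ('b, 'a tvec) connection \<Rightarrow> bool" where
  "pullback_connection A B i nab D \<longleftrightarrow>
     connection_along A B i D \<and>
     (\<forall>W\<in>vector_fields B. \<forall>p. \<forall>u\<in>tangent_space A p.
        D p u (W \<circ> i) = nab (i p) (differential B i u) W)"

definition normal_space ::
  "('b, 'f::euclidean_space) atlas \<Rightarrow> ('a, 'e::euclidean_space) atlas \<Rightarrow> ('b \<Rightarrow> 'a) \<Rightarrow> 'a metric \<Rightarrow>
   'b \<Rightarrow> 'a tvec set" where
  "normal_space A B i g p = {w \<in> tangent_space B (i p).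
     \<forall>u\<in>tangent_space A p. g (i p) w (differential B i u) = 0}"

definition normal_part ::
  "('b, 'f::euclidean_space) atlas \<Rightarrow> ('a, 'e::euclidean_space) atlas \<Rightarrow> ('b \<Rightarrow> 'a) \<Rightarrow> 'a metric \<Rightarrow>
   'b \<Rightarrow> 'a tvec \<Rightarrow> 'a tvec" where
  "normal_part A B i g p w = (THE n. n \<in> normal_space A B i g p \<and>
     w - n \<in> differential B i ` tangent_space A p)"

definition normal_connection ::
  "('b, 'f::euclidean_space) atlas \<Rightarrow> ('a, 'e::euclidean_space) atlas \<Rightarrow> ('b \<Rightarrow> 'a) \<Rightarrow> 'a metric \<Rightarrow>
   ('b, 'a tvec) connection \<Rightarrow> ('b, 'a tvec) connection" where
  "normal_connection A B i g D = (\<lambda>p u N. normal_part A B i g p (D p u N))"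

text \<open>Here \<open>h\<close> is defined by the Gauss formula; for \<open>D\<close> the pullback of the ambient Levi-Civita
  connection and \<open>nab\<close> the Levi-Civita connection of the induced metric it is normal to \<open>M\<close>.\<close>

definition second_fundamental_form ::
  "('a, 'e::euclidean_space) atlas \<Rightarrow> ('b \<Rightarrow> 'a) \<Rightarrow>
   ('b, 'a tvec) connection \<Rightarrow> ('b, 'b tvec) connection \<Rightarrow>
   ('b \<Rightarrow> 'b tvec) \<Rightarrow> ('b \<Rightarrow> 'b tvec) \<Rightarrow> 'b \<Rightarrow> 'a tvec" where
  "second_fundamental_form B i D nab X Y =
     cov D X (differential B i \<circ> Y) - (differential B i \<circ> cov nab X Y)"

definition totally_geodesic ::
  "('b, 'f::euclidean_space) atlas \<Rightarrow> ('a, 'e::euclidean_space) atlas \<Rightarrow> ('b \<Rightarrow> 'a) \<Rightarrow>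
   ('b, 'a tvec) connection \<Rightarrow> ('b, 'b tvec) connection \<Rightarrow> bool" where
  "totally_geodesic A B i D nab \<longleftrightarrow>
     (\<forall>X\<in>vector_fields A. \<forall>Y\<in>vector_fields A. second_fundamental_form B i D nab X Y = 0)"

definition cov_second_fundamental_form ::
  "('b, 'f::euclidean_space) atlas \<Rightarrow> ('a, 'e::euclidean_space) atlas \<Rightarrow> ('b \<Rightarrow> 'a) \<Rightarrow> 'a metric \<Rightarrow>
   ('b, 'a tvec) connection \<Rightarrow> ('b, 'b tvec) connection \<Rightarrow>
   ('b \<Rightarrow> 'b tvec) \<Rightarrow> ('b \<Rightarrow> 'b tvec) \<Rightarrow> ('b \<Rightarrow> 'b tvec) \<Rightarrow> 'b \<Rightarrow> 'a tvec" where
  "cov_second_fundamental_form A B i g D nab Z U W =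
     (let h = second_fundamental_form B i D nab in
      cov (normal_connection A B i g D) Z (h U W) - h (cov nab Z U) W - h U (cov nab Z W))"

definition two_semiparallel ::
  "('b, 'f::euclidean_space) atlas \<Rightarrow> ('a, 'e::euclidean_space) atlas \<Rightarrow> ('b \<Rightarrow> 'a) \<Rightarrow> 'a metric \<Rightarrow>
   ('b, 'a tvec) connection \<Rightarrow> ('b, 'b tvec) connection \<Rightarrow> bool" where
  "two_semiparallel A B i g D nab \<longleftrightarrow>
     (let nabh = cov_second_fundamental_form A B i g D nab;
          R = curvature nab;
          Rperp = curvature (normal_connection A B i g D) in
      \<forall>X\<in>vector_fields A. \<forall>Y\<in>vector_fields A.
      \<forall>Z\<in>vector_fields A. \<forall>U\<in>vector_fields A. \<forall>W\<in>vector_fields A.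
        Rperp X Y (nabh Z U W) - nabh (R X Y Z) U W - nabh Z (R X Y U) W - nabh Z U (R X Y W) = 0)"

end

theory Submission
  imports Defs
begin

text \<open>
  Write \<open>c = f\<^sub>1 - f\<^sub>3\<close>. Since \<open>\<nabla>\<^sub>X \<xi> = - c \<phi> X\<close> is tangent to \<open>M\<close>, we have \<open>h(X, \<xi>) = 0\<close>.
  Evaluating 2-semiparallelity at \<open>U = W = Y = \<xi>\<close> leaves
  \<open>2 h(R(X, \<xi>)\<xi>, \<nabla>\<^sub>Z \<xi>) = 0\<close>, and the structure equations give
  \<open>R(X, \<xi>)\<xi> = \<xi>(c) \<phi> X - c\<^sup>2 \<phi>\<^sup>2 X\<close>. Replacing \<open>X\<close> by \<open>\<phi> X\<close> turns this into a linear system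
  for \<open>h(\<phi> X, \<phi> Z)\<close> and \<open>h(\<phi>\<^sup>2 X, \<phi> Z)\<close> with determinant \<open>\<xi>(c)\<^sup>2 + c\<^sup>4 > 0\<close>, so \<open>h\<close> vanishes
  on the image of \<open>\<phi>\<close>, hence everywhere.

  Fields that are only given along \<open>M\<close> are reduced to restrictions of ambient fields by tensoriality.
  This needs a local frame in the space of derivations, which Hadamard's lemma and bump functions
  provide. That \<open>\<xi>\<close> and \<open>\<phi> X\<close> are smooth as fields on \<open>M\<close> follows by
  solving a linear system over the ring of smooth functions.
\<close>

section \<open>Calculus of smooth maps\<close>

text \<open>The slots U = W = \<xi> are taken because h(X, \<xi>) is the zero section, not merely
  zero at a point: the normal derivatives that occur are derivatives of zero, the normal curvature
  acts on zero, and only the two terms in which R(X, \<xi>) hits \<xi> survive. Since c is not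
  assumed constant, the term \<xi>(c) \<phi> X stays in R(X, \<xi>)\<xi>, which is why a 2 by 2
  system appears instead of the single equation c^2 h = 0. The hypothesis that f1 and f3 differ
  enters twice: it cancels the factor c in \<nabla>_Z \<xi> = - c \<phi> Z, and it makes c^4 in the
  determinant positive. The analytic obstacle is that the ambient identities (structure equations,
  torsion, metric compatibility) are given for global ambient fields, whereas a field of M pushed
  forward by an immersion need not extend to one; \<open>i\<close> may even fail to be injective.
  Each identity is therefore transferred at one point at a time, by function-linearity or, for the
  torsion, by a frame formula that sees only the values at that point.\<close>

lemma differentiable_on_open_has_derivative:
  assumes "open S" "f differentiable_on S" "x \<in> S"
  shows "(f has_derivative frechet_derivative f (at x)) (at x)"
  using assms by (metis at_within_open differentiable_on_def frechet_derivative_works)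

lemma Ck_on_cong:
  assumes S: "open S" and "\<And>x. x \<in> S \<Longrightarrow> f x = g x" "Ck_on k S f"
  shows "Ck_on k S g"
  using assms(2,3)
proof (induction k arbitrary: f g)
  case 0
  then show ?case by (simp cong: continuous_on_cong)
next
  case (Suc k)
  have iff: "(f has_derivative D) (at x) \<longleftrightarrow> (g has_derivative D) (at x)" if "x \<in> S" for D x
    using has_derivative_transform_within_open[OF _ S that] Suc.prems(1) by metis
  then have "frechet_derivative f (at x) = frechet_derivative g (at x)" if "x \<in> S" for x
    using that by (simp add: frechet_derivative_def)
  moreover have "g differentiable_on S"
    unfolding differentiable_on_def
  proof
    fix x assume x: "x \<in> S"
    have "f differentiable_on S" using Suc.prems(2) by simp
    then have "(g has_derivative frechet_derivative f (at x)) (at x)"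
      using differentiable_on_open_has_derivative[OF S _ x] iff[OF x] by blast
    then show "g differentiable at x within S"
      by (meson differentiableI differentiable_at_withinI)
  qed
  ultimately show ?case
    using Suc.prems(2) Suc.IH[of "\<lambda>x. frechet_derivative f (at x) v"
        "\<lambda>x. frechet_derivative g (at x) v" for v]
    by simp
qed

text \<open>\<open>frechet_derivative\<close> is a choice operator. Uniqueness of derivatives on an
  open set lets every later regularity proof exhibit an explicit derivative family instead.\<close>

lemma Ck_on_Suc_iff:
  assumes S: "open S"
  shows "Ck_on (Suc k) S f \<longleftrightarrow>
    (\<exists>f'. (\<forall>x\<in>S. (f has_derivative f' x) (at x)) \<and> (\<forall>v. Ck_on k S (\<lambda>x. f' x v)))"
    (is "?L \<longleftrightarrow> ?R")
proof
  assume ?L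
  then have "\<forall>x\<in>S. (f has_derivative frechet_derivative f (at x)) (at x)"
    using differentiable_on_open_has_derivative[OF S, of f] by simp
  with \<open>?L\<close> show ?R by auto
next
  assume ?R
  then obtain f' where f': "\<And>x. x \<in> S \<Longrightarrow> (f has_derivative f' x) (at x)"
    and k: "\<And>v. Ck_on k S (\<lambda>x. f' x v)" by blast
  have "frechet_derivative f (at x) = f' x" if "x \<in> S" for x
    using frechet_derivative_at[OF f'[OF that]] by simp
  then have "Ck_on k S (\<lambda>x. frechet_derivative f (at x) v)" for v
    by (intro Ck_on_cong[OF S _ k]) simp
  moreover have "f differentiable_on S"
    using f' by (auto simp: differentiable_on_def intro: differentiable_at_withinI differentiableI)
  ultimately show ?L by simp
qed

lemma Ck_on_SucE:
  assumes "Ck_on (Suc k) S f" "open S"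
  obtains f' where "\<And>x. x \<in> S \<Longrightarrow> (f has_derivative f' x) (at x)" "\<And>v. Ck_on k S (\<lambda>x. f' x v)"
  using assms(1) that unfolding Ck_on_Suc_iff[OF assms(2)] by blast

lemma Ck_on_continuous:
  assumes "open S" "Ck_on k S f"
  shows "continuous_on S f"
  using assms by (cases k) (auto intro: differentiable_imp_continuous_on)

lemma Ck_on_Suc_imp:
  assumes "open S" "Ck_on (Suc k) S f"
  shows "Ck_on k S f"
  using assms
proof (induction k arbitrary: f)
  case 0
  then show ?case using Ck_on_continuous by fastforce
next
  case (Suc k)
  show ?case
    using Ck_on_SucE[OF Suc.prems(2,1)] Suc.IH[OF Suc.prems(1)] Ck_on_Suc_iff[OF Suc.prems(1)]
    by metis
qed

text \<open>The derivative is a pointwise notion, so all local pieces refer to the same function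
  \<open>frechet_derivative f (at x)\<close>, and the induction applies to it.\<close>

lemma Ck_on_local:
  assumes S: "open S" and loc: "\<And>x. x \<in> S \<Longrightarrow> \<exists>T. open T \<and> x \<in> T \<and> Ck_on k T f"
  shows "Ck_on k S f"
  using loc
proof (induction k arbitrary: f)
  case 0
  have "continuous (at x within S) f" if "x \<in> S" for x
    using 0[OF that] that by (auto simp: continuous_on_eq_continuous_at intro: continuous_at_imp_continuous_at_within)
  then show ?case by (simp add: continuous_on_eq_continuous_within)
next
  case (Suc k)
  let ?f' = "\<lambda>x. frechet_derivative f (at x)"
  have "(f has_derivative ?f' x) (at x)" if "x \<in> S" for x
    using Suc.prems[OF that] differentiable_on_open_has_derivative that by fastforce
  moreover have "Ck_on k S (\<lambda>x. ?f' x v)" for v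
  proof (rule Suc.IH)
    fix x assume "x \<in> S"
    from Suc.prems[OF this] show "\<exists>T. open T \<and> x \<in> T \<and> Ck_on k T (\<lambda>x. ?f' x v)" by auto
  qed
  ultimately show ?case
    unfolding Ck_on_Suc_iff[OF S] by (intro exI[of _ ?f']) simp
qed

lemma Ck_on_subset:
  assumes "Ck_on k S f" "open S" "open T" "T \<subseteq> S"
  shows "Ck_on k T f"
  using assms(1)
proof (induction k arbitrary: f)
  case 0
  then show ?case using assms continuous_on_subset by auto
next
  case (Suc k)
  then show ?case using assms by (auto intro: differentiable_on_subset)
qed

lemma Ck_on_const: "open S \<Longrightarrow> Ck_on k S (\<lambda>x. c)"
proof (induction k arbitrary: c)
  case (Suc k)
  have "((\<lambda>x. c) has_derivative (\<lambda>v. 0)) (at x)" for x :: 'a by simp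
  with Suc show ?case
    unfolding Ck_on_Suc_iff[OF Suc.prems] by (intro exI[of _ "\<lambda>x v. 0"]) auto
qed simp

lemma Ck_on_bounded_linear_comp:
  assumes "bounded_linear L" "open S" "Ck_on k S f"
  shows "Ck_on k S (\<lambda>x. L (f x))"
  using assms(3)
proof (induction k arbitrary: f)
  case 0
  then show ?case using assms(1) by (auto intro: bounded_linear.continuous_on)
next
  case (Suc k)
  then obtain f' where f': "\<And>x. x \<in> S \<Longrightarrow> (f has_derivative f' x) (at x)"
    and k: "\<And>v. Ck_on k S (\<lambda>x. f' x v)"
    using assms(2) by (auto simp: Ck_on_Suc_iff simp del: Ck_on.simps)
  have "((\<lambda>x. L (f x)) has_derivative (\<lambda>v. L (f' x v))) (at x)" if "x \<in> S" for x
    using bounded_linear.has_derivative[OF assms(1) f'[OF that]] .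
  with Suc.IH[OF k] show ?case
    unfolding Ck_on_Suc_iff[OF assms(2)] by (intro exI[of _ "\<lambda>x v. L (f' x v)"]) auto
qed

lemma Ck_on_bounded_linear:
  assumes "bounded_linear L" "open S"
  shows "Ck_on k S L"
proof (rule Ck_on_bounded_linear_comp[where f = "\<lambda>x. x", OF assms])
  show "Ck_on k S (\<lambda>x. x)"
  proof (cases k)
    case (Suc j)
    then show ?thesis
      unfolding Suc Ck_on_Suc_iff[OF assms(2)]
      by (intro exI[of _ "\<lambda>x v. v"]) (auto simp: Ck_on_const[OF assms(2)])
  qed simp
qed

lemma Ck_on_add:
  assumes S: "open S" and "Ck_on k S f" "Ck_on k S g"
  shows "Ck_on k S (\<lambda>x. f x + g x)"
  using assms(2,3)
proof (induction k arbitrary: f g)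
  case 0
  then show ?case by (auto intro: continuous_intros)
next
  case (Suc k)
  obtain f' g' where f': "\<And>x. x \<in> S \<Longrightarrow> (f has_derivative f' x) (at x)"
    "\<And>x. x \<in> S \<Longrightarrow> (g has_derivative g' x) (at x)"
    and k: "\<And>v. Ck_on k S (\<lambda>x. f' x v)" "\<And>v. Ck_on k S (\<lambda>x. g' x v)"
    using Ck_on_SucE[OF Suc.prems(1) S] Ck_on_SucE[OF Suc.prems(2) S] by metis
  have "((\<lambda>x. f x + g x) has_derivative (\<lambda>v. f' x v + g' x v)) (at x)" if "x \<in> S" for x
    using f'[OF that] by (intro has_derivative_add)
  with Suc.IH[OF k] show ?case
    unfolding Ck_on_Suc_iff[OF S] by (intro exI[of _ "\<lambda>x v. f' x v + g' x v"]) auto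
qed

lemma Ck_on_scaleR:
  fixes f :: "'e::real_normed_vector \<Rightarrow> real"
  assumes S: "open S" and "Ck_on k S f" "Ck_on k S g"
  shows "Ck_on k S (\<lambda>x. f x *\<^sub>R g x)"
  using assms(2,3)
proof (induction k arbitrary: f g)
  case 0
  then show ?case by (auto intro: continuous_intros)
next
  case (Suc k)
  obtain f' g' where f': "\<And>x. x \<in> S \<Longrightarrow> (f has_derivative f' x) (at x)"
    "\<And>x. x \<in> S \<Longrightarrow> (g has_derivative g' x) (at x)"
    and k: "\<And>v. Ck_on k S (\<lambda>x. f' x v)" "\<And>v. Ck_on k S (\<lambda>x. g' x v)"
    using Ck_on_SucE[OF Suc.prems(1) S] Ck_on_SucE[OF Suc.prems(2) S] by metis
  have "((\<lambda>x. f x *\<^sub>R g x) has_derivative (\<lambda>v. f x *\<^sub>R g' x v + f' x v *\<^sub>R g x)) (at x)"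
    if "x \<in> S" for x
    using has_derivative_scaleR[OF f'[OF that]] .
  moreover have "Ck_on k S (\<lambda>x. f x *\<^sub>R g' x v + f' x v *\<^sub>R g x)" for v
    by (intro Ck_on_add[OF S] Suc.IH Suc.prems[THEN Ck_on_Suc_imp[OF S]] k)
  ultimately show ?case
    unfolding Ck_on_Suc_iff[OF S]
    by (intro exI[of _ "\<lambda>x v. f x *\<^sub>R g' x v + f' x v *\<^sub>R g x"]) auto
qed

lemma Ck_on_mult:
  fixes f g :: "'e::real_normed_vector \<Rightarrow> real"
  assumes "open S" "Ck_on k S f" "Ck_on k S g"
  shows "Ck_on k S (\<lambda>x. f x * g x)"
  using Ck_on_scaleR[OF assms] by simp

lemma Ck_on_sum:
  assumes "open S" "\<And>a. a \<in> I \<Longrightarrow> Ck_on k S (f a)"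
  shows "Ck_on k S (\<lambda>x. \<Sum>a\<in>I. f a x)"
  using assms(2)
  by (induction I rule: infinite_finite_induct) (auto intro: Ck_on_add Ck_on_const assms(1))

text \<open>In the chain rule g' is applied to the direction f' x v, which varies with x, whereas
  \<open>Ck_on\<close> controls derivatives in fixed directions. Expanding f' x v in the basis of
  the Euclidean middle space leaves scalars of class C^k times derivatives of g in basis directions,
  composed with f.\<close>

lemma Ck_on_compose:
  fixes f :: "'e::real_normed_vector \<Rightarrow> 'f::euclidean_space"
    and g :: "'f \<Rightarrow> 'g::real_normed_vector"
  assumes S: "open S" and T: "open T" and "Ck_on k S f" "Ck_on k T g" and fS: "f ` S \<subseteq> T"
  shows "Ck_on k S (\<lambda>x. g (f x))"
  using assms(3,4)
proof (induction k arbitrary: g)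
  case 0
  then show ?case using fS by (auto intro: continuous_on_compose2)
next
  case (Suc k)
  obtain f' g' where f': "\<And>x. x \<in> S \<Longrightarrow> (f has_derivative f' x) (at x)"
    "\<And>x. x \<in> T \<Longrightarrow> (g has_derivative g' x) (at x)"
    and k: "\<And>v. Ck_on k S (\<lambda>x. f' x v)" "\<And>v. Ck_on k T (\<lambda>x. g' x v)"
    using Ck_on_SucE[OF Suc.prems(1) S] Ck_on_SucE[OF Suc.prems(2) T] by metis
  let ?D = "\<lambda>x v. \<Sum>b\<in>Basis. (f' x v \<bullet> b) *\<^sub>R g' (f x) b"
  have "((\<lambda>x. g (f x)) has_derivative ?D x) (at x)" if "x \<in> S" for x
  proof -
    have g: "(g has_derivative g' (f x)) (at (f x))" using f'(2) fS that by blast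
    interpret g: bounded_linear "g' (f x)" using g by (rule has_derivative_bounded_linear)
    have "g' (f x) (f' x v) = ?D x v" for v
      by (subst euclidean_representation[symmetric, of "f' x v"]) (simp add: g.sum g.scaleR)
    then show ?thesis using has_derivative_compose[OF f'(1)[OF that] g] by simp
  qed
  moreover have "Ck_on k S (\<lambda>x. ?D x v)" for v
  proof (intro Ck_on_sum Ck_on_scaleR S)
    show "Ck_on k S (\<lambda>x. f' x v \<bullet> b)" for b
      by (rule Ck_on_bounded_linear_comp[OF bounded_linear_inner_left S k(1)])
    show "Ck_on k S (\<lambda>x. g' (f x) b)" for b
      using Suc.IH[OF Ck_on_Suc_imp[OF S Suc.prems(1)] k(2)] .
  qed
  ultimately show ?case unfolding Ck_on_Suc_iff[OF S] by (intro exI[of _ ?D]) simp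
qed

text \<open>The derivative of 1/f is a product of f' and two factors 1/f, so regularity of 1/f at
  order k feeds the step to k + 1.\<close>

lemma Ck_on_inverse:
  fixes f :: "'e::real_normed_vector \<Rightarrow> real"
  assumes S: "open S" and "Ck_on k S f" and nz: "\<And>x. x \<in> S \<Longrightarrow> f x \<noteq> 0"
  shows "Ck_on k S (\<lambda>x. inverse (f x))"
  using assms(2)
proof (induction k)
  case 0
  then show ?case using nz by (auto intro: continuous_intros)
next
  case (Suc k)
  then obtain f' where f': "\<And>x. x \<in> S \<Longrightarrow> (f has_derivative f' x) (at x)"
    and k: "\<And>v. Ck_on k S (\<lambda>x. f' x v)"
    unfolding Ck_on_Suc_iff[OF S] by blast
  let ?D = "\<lambda>x v. - 1 * (inverse (f x) * f' x v * inverse (f x))"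
  have "((\<lambda>x. inverse (f x)) has_derivative ?D x) (at x)" if "x \<in> S" for x
    using Deriv.has_derivative_inverse[OF nz[OF that] f'[OF that]] by simp
  moreover have "Ck_on k S (\<lambda>x. ?D x v)" for v
    using Suc.IH[OF Ck_on_Suc_imp[OF S Suc.prems]] k
    by (intro Ck_on_mult Ck_on_const S)
  ultimately show ?case unfolding Ck_on_Suc_iff[OF S] by (intro exI[of _ ?D]) simp
qed

section \<open>Closure properties of smooth maps\<close>

lemma smooth_on_cong:
  assumes "open S" "\<And>x. x \<in> S \<Longrightarrow> f x = g x" "smooth_on S f"
  shows "smooth_on S g"
  using assms Ck_on_cong unfolding smooth_on_def by blast

lemma smooth_on_subset: "smooth_on S f \<Longrightarrow> open S \<Longrightarrow> open T \<Longrightarrow> T \<subseteq> S \<Longrightarrow> smooth_on T f"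
  using Ck_on_subset unfolding smooth_on_def by blast

lemma smooth_on_local:
  assumes "open S" "\<And>x. x \<in> S \<Longrightarrow> \<exists>T. open T \<and> x \<in> T \<and> smooth_on T f"
  shows "smooth_on S f"
  using assms Ck_on_local unfolding smooth_on_def by metis

lemma smooth_on_const: "open S \<Longrightarrow> smooth_on S (\<lambda>x. c)"
  by (simp add: smooth_on_def Ck_on_const)

lemma smooth_on_add: "open S \<Longrightarrow> smooth_on S f \<Longrightarrow> smooth_on S g \<Longrightarrow> smooth_on S (\<lambda>x. f x + g x)"
  by (simp add: smooth_on_def Ck_on_add)

lemma smooth_on_mult:
  fixes f g :: "'e::real_normed_vector \<Rightarrow> real"
  shows "open S \<Longrightarrow> smooth_on S f \<Longrightarrow> smooth_on S g \<Longrightarrow> smooth_on S (\<lambda>x. f x * g x)"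
  by (simp add: smooth_on_def Ck_on_mult)

lemma smooth_on_bounded_linear: "bounded_linear L \<Longrightarrow> open S \<Longrightarrow> smooth_on S L"
  by (simp add: smooth_on_def Ck_on_bounded_linear)

lemma smooth_on_sum:
  "open S \<Longrightarrow> (\<And>a. a \<in> I \<Longrightarrow> smooth_on S (f a)) \<Longrightarrow> smooth_on S (\<lambda>x. \<Sum>a\<in>I. f a x)"
  by (simp add: smooth_on_def Ck_on_sum)

lemma smooth_on_inverse:
  fixes f :: "'e::real_normed_vector \<Rightarrow> real"
  shows "open S \<Longrightarrow> smooth_on S f \<Longrightarrow> (\<And>x. x \<in> S \<Longrightarrow> f x \<noteq> 0) \<Longrightarrow> smooth_on S (\<lambda>x. inverse (f x))"
  by (simp add: smooth_on_def Ck_on_inverse)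

lemma smooth_on_compose:
  fixes f :: "'e::real_normed_vector \<Rightarrow> 'f::euclidean_space"
    and g :: "'f \<Rightarrow> 'g::real_normed_vector"
  assumes "open S" "open T" "smooth_on S f" "smooth_on T g" "f ` S \<subseteq> T"
  shows "smooth_on S (\<lambda>x. g (f x))"
  using assms Ck_on_compose unfolding smooth_on_def by blast

lemma smooth_on_continuous: "open S \<Longrightarrow> smooth_on S f \<Longrightarrow> continuous_on S f"
  using Ck_on_continuous unfolding smooth_on_def by blast

lemma smooth_on_has_derivative:
  assumes "open S" "smooth_on S f" "x \<in> S"
  shows "(f has_derivative frechet_derivative f (at x)) (at x)"
proof -
  have "Ck_on (Suc 0) S f" using assms(2) unfolding smooth_on_def by blast
  then show ?thesis
    using assms(1,3) differentiable_on_open_has_derivative by auto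
qed

lemma smooth_on_derivative:
  assumes "smooth_on S f"
  shows "smooth_on S (\<lambda>x. frechet_derivative f (at x) v)"
  using assms unfolding smooth_on_def by (metis Ck_on.simps(2))

lemma smooth_on_diff:
  fixes f g :: "'e::real_normed_vector \<Rightarrow> real"
  assumes "open S" "smooth_on S f" "smooth_on S g"
  shows "smooth_on S (\<lambda>x. f x - g x)"
  using smooth_on_add[OF assms(1,2) smooth_on_mult[OF assms(1) smooth_on_const[OF assms(1), of "-1"] assms(3)]]
  by simp

section \<open>Bump functions and Hadamard's lemma\<close>

text \<open>For t > 0 this is t^(-m) exp(-1/t). The exponent m closes the family under
  differentiation; the bump functions use \<open>flat 0\<close>, and the others occur in its
  derivatives.\<close>

definition flat :: "nat \<Rightarrow> real \<Rightarrow> real" where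
  "flat m t = (if t > 0 then inverse t ^ m * exp (- inverse t) else 0)"

lemma flat_has_derivative:
  "(flat m has_real_derivative (- real m * flat (m + 1) t + flat (m + 2) t)) (at t)"
proof -
  consider "t > 0" | "t < 0" | "t = 0" by linarith
  then show ?thesis
  proof cases
    case 1
    have p: "((\<lambda>t. inverse t ^ m) has_real_derivative - real m * inverse t ^ (m + 1)) (at t)"
      using DERIV_power[OF DERIV_inverse, of t m] 1 by (cases m) (simp_all add: algebra_simps)
    have e: "((\<lambda>t. exp (- inverse t)) has_real_derivative exp (- inverse t) * inverse t ^ 2) (at t)"
      using 1 by (auto intro!: derivative_eq_intros simp: power2_eq_square)
    have "((\<lambda>t. inverse t ^ m * exp (- inverse t)) has_real_derivative
        (- real m * flat (m + 1) t + flat (m + 2) t)) (at t)"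
      using DERIV_mult[OF p e] 1 by (simp add: flat_def power2_eq_square algebra_simps)
    then show ?thesis
      by (rule has_field_derivative_transform_within_open[of _ _ _ "{0<..}"])
        (use 1 in \<open>auto simp: flat_def\<close>)
  next
    case 2
    have "((\<lambda>t. 0) has_real_derivative (- real m * flat (m + 1) t + flat (m + 2) t)) (at t)"
      using 2 by (simp add: flat_def)
    then show ?thesis
      by (rule has_field_derivative_transform_within_open[of _ _ _ "{..<0}"])
        (use 2 in \<open>auto simp: flat_def\<close>)
  next
    case 3
    \<comment> \<open>In the variable s = 1/h the difference quotient at 0 from the right is s^(m+1)
      / exp s, with s tending to infinity.\<close>
    have "((\<lambda>h. inverse h ^ (m + 1) / exp (inverse h)) \<longlongrightarrow> 0) (at_right (0::real))"
      by (rule filterlim_compose[OF tendsto_power_div_exp_0 filterlim_inverse_at_top_right])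
    then have R: "((\<lambda>h. flat m h / h) \<longlongrightarrow> 0) (at_right 0)"
      by (rule tendsto_cong[THEN iffD1, rotated])
        (auto simp: eventually_at_filter flat_def exp_minus divide_inverse mult_ac)
    have L: "((\<lambda>h. flat m h / h) \<longlongrightarrow> 0) (at_left 0)"
      by (rule tendsto_cong[THEN iffD1, OF _ tendsto_const])
        (auto simp: eventually_at_filter flat_def)
    from L R have "((\<lambda>h. flat m h / h) \<longlongrightarrow> 0) (at 0)"
      by (rule filterlim_split_at)
    then show ?thesis
      using 3 by (simp add: DERIV_def flat_def)
  qed
qed

lemma smooth_on_flat: "smooth_on UNIV (flat m)"
proof -
  have "Ck_on k UNIV (flat m)" for k
  proof (induction k arbitrary: m)
    case 0
    show ?case
      using flat_has_derivative DERIV_continuous by (force simp: continuous_on_eq_continuous_at)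
  next
    case (Suc k)
    let ?D = "\<lambda>t v. (- real m * flat (m + 1) t + flat (m + 2) t) * v"
    have "(flat m has_derivative ?D t) (at t)" for t
      using flat_has_derivative[of m t] by (simp add: has_field_derivative_def)
    moreover have "Ck_on k UNIV (\<lambda>t. ?D t v)" for v
      by (intro Ck_on_mult Ck_on_add Ck_on_const Suc.IH) auto
    ultimately show ?case
      unfolding Ck_on_Suc_iff[OF open_UNIV] by (intro exI[of _ ?D]) simp
  qed
  then show ?thesis by (simp add: smooth_on_def)
qed

lemma smooth_bump_function:
  fixes y0 :: "'e::euclidean_space"
  assumes "0 < r" "r < R"
  obtains \<beta> :: "'e \<Rightarrow> real" where "smooth_on UNIV \<beta>"
    "\<And>y. y \<in> cball y0 r \<Longrightarrow> \<beta> y = 1" "\<And>y. y \<notin> ball y0 R \<Longrightarrow> \<beta> y = 0"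
proof -
  \<comment> \<open>A smooth step: 0 for t \<le> 0 and 1 for t \<ge> 1. The denominator is positive
    because t and 1 - t cannot both be nonpositive.\<close>
  define \<sigma> where "\<sigma> t = flat 0 t * inverse (flat 0 t + flat 0 (1 + - 1 * t))" for t
  have pos: "flat 0 t + flat 0 (1 + - 1 * t) > 0" for t
    by (auto simp: flat_def add_pos_pos)
  have "smooth_on UNIV (\<lambda>t::real. 1 + - 1 * t)"
    by (intro smooth_on_add smooth_on_const smooth_on_bounded_linear open_UNIV
        bounded_linear_mult_right)
  then have f1: "smooth_on UNIV (\<lambda>t. flat 0 (1 + - 1 * t))"
    using smooth_on_compose[OF open_UNIV open_UNIV _ smooth_on_flat] by blast
  have f2: "smooth_on UNIV (\<lambda>t. inverse (flat 0 t + flat 0 (1 + - 1 * t)))"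
    using pos by (intro smooth_on_inverse smooth_on_add smooth_on_flat f1 open_UNIV) (metis less_irrefl)
  have \<sigma>: "smooth_on UNIV \<sigma>"
    unfolding \<sigma>_def by (rule smooth_on_mult[OF open_UNIV smooth_on_flat f2])
  have d: "R\<^sup>2 - r\<^sup>2 > 0" using assms by (simp add: power_strict_mono)
  \<comment> \<open>Affine in the squared distance, at least 1 on the inner ball and at most 0
    outside the outer one. Squaring avoids the norm, which is not smooth at the centre; in
    coordinates \<open>q\<close> is a polynomial.\<close>
  define q where "q y = (R\<^sup>2 + - 1 * (\<Sum>b\<in>Basis. (y \<bullet> b + - (y0 \<bullet> b)) * (y \<bullet> b + - (y0 \<bullet> b)))) * inverse (R\<^sup>2 - r\<^sup>2)"
    for y
  have q: "q y = (R\<^sup>2 - (dist y0 y)\<^sup>2) / (R\<^sup>2 - r\<^sup>2)" for y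
  proof -
    have "(dist y0 y)\<^sup>2 = (y - y0) \<bullet> (y - y0)"
      by (metis dist_commute dist_norm power2_norm_eq_inner)
    also have "\<dots> = (\<Sum>b\<in>Basis. (y \<bullet> b + - (y0 \<bullet> b)) * (y \<bullet> b + - (y0 \<bullet> b)))"
      by (subst euclidean_inner) (simp add: inner_diff_left)
    finally show ?thesis by (simp add: q_def divide_inverse)
  qed
  have lin: "smooth_on UNIV (\<lambda>y. y \<bullet> b + - (y0 \<bullet> b))" for b
    by (intro smooth_on_add smooth_on_const smooth_on_bounded_linear open_UNIV
        bounded_linear_inner_left)
  have "smooth_on UNIV (\<lambda>y. \<Sum>b\<in>Basis. (y \<bullet> b + - (y0 \<bullet> b)) * (y \<bullet> b + - (y0 \<bullet> b)))"
    by (intro smooth_on_sum smooth_on_mult lin open_UNIV)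
  then have "smooth_on UNIV q"
    unfolding q_def
    by (intro smooth_on_mult[OF open_UNIV] smooth_on_add[OF open_UNIV] smooth_on_const[OF open_UNIV])
  then have "smooth_on UNIV (\<lambda>y. \<sigma> (q y))"
    by (intro smooth_on_compose[OF _ _ _ \<sigma>]) auto
  moreover have "\<sigma> (q y) = 1" if "y \<in> cball y0 r" for y
  proof -
    have "(dist y0 y)\<^sup>2 \<le> r\<^sup>2" using that by (simp add: power_mono)
    then have "q y \<ge> 1" unfolding q using d by (simp add: le_divide_eq)
    then show ?thesis by (simp add: \<sigma>_def flat_def)
  qed
  moreover have "\<sigma> (q y) = 0" if "y \<notin> ball y0 R" for y
  proof -
    have "R\<^sup>2 \<le> (dist y0 y)\<^sup>2" using that assms by (simp add: power_mono)
    then have "q y \<le> 0" unfolding q using d by (simp add: divide_le_0_iff)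
    then show ?thesis by (simp add: \<sigma>_def flat_def)
  qed
  ultimately show ?thesis by (rule that)
qed

text \<open>Differentiating under the integral in direction v brings down a factor t, so the
  derivative is an integral of the same shape with m + 1 and with the derivative of F along v. The
  weight t^m is there to make this family closed under differentiation.\<close>

lemma smooth_on_segment_integral:
  fixes F :: "'e::euclidean_space \<Rightarrow> real"
  assumes S: "open S" "convex S" "y0 \<in> S" and F: "smooth_on S F"
  shows "smooth_on S (\<lambda>x. integral {0..1} (\<lambda>t. t ^ m * F (y0 + t *\<^sub>R (x - y0))))"
proof -
  let ?I = "\<lambda>m F x. integral {0..1} (\<lambda>t. t ^ m * F (y0 + t *\<^sub>R (x - y0)))"
  have seg: "y0 + t *\<^sub>R (x - y0) \<in> S" if "x \<in> S" "t \<in> {0..1}" for x t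
    using convexD_alt[OF S(2,3) that(1), of t] that(2) by (simp add: algebra_simps)
  have cont: "continuous_on (S \<times> {0..1}) (\<lambda>z. snd z ^ m * F (y0 + snd z *\<^sub>R (fst z - y0)))"
    if "smooth_on S F" for F :: "'e \<Rightarrow> real" and m
    using seg
    by (intro continuous_intros continuous_on_compose2[OF smooth_on_continuous[OF S(1) that]]) auto
  have cont1: "continuous_on {0..1} (\<lambda>t. t ^ m * F (y0 + t *\<^sub>R (x - y0)))"
    if "smooth_on S F" "x \<in> S" for F :: "'e \<Rightarrow> real" and m x
    using that(2) by (intro continuous_on_compose2[OF cont[OF that(1)], of _ "\<lambda>t. (x, t)", simplified] continuous_intros) auto
  have der: "(?I m F has_derivative (\<lambda>v. ?I (Suc m) (\<lambda>x. frechet_derivative F (at x) v) x)) (at x)"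
    if F: "smooth_on S F" and x: "x \<in> S" for F m x
  proof -
    let ?F' = "\<lambda>x. frechet_derivative F (at x)"
    \<comment> \<open>The Leibniz rule asks for the derivative of the integrand as a bounded linear
      operator, jointly continuous in (x, t). It is assembled from partial derivatives, whose joint
      continuity is \<open>cont\<close>.\<close>
    define fx where "fx x t = (\<Sum>b\<in>Basis. (t ^ Suc m * ?F' (y0 + t *\<^sub>R (x - y0)) b) *\<^sub>R blinfun_inner_left b)"
      for x :: 'e and t
    have fx: "blinfun_apply (fx x t) v = t ^ Suc m * ?F' (y0 + t *\<^sub>R (x - y0)) v"
      if "x \<in> S" "t \<in> {0..1}" for x t v
    proof -
      interpret l: bounded_linear "?F' (y0 + t *\<^sub>R (x - y0))"
        using smooth_on_has_derivative[OF S(1) F seg[OF that]] by (rule has_derivative_bounded_linear)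
      have "?F' (y0 + t *\<^sub>R (x - y0)) v
          = (\<Sum>b\<in>Basis. (v \<bullet> b) * ?F' (y0 + t *\<^sub>R (x - y0)) b)"
        by (subst euclidean_representation[symmetric, of v]) (simp add: l.sum l.scaleR)
      then show ?thesis
        by (simp add: fx_def blinfun.sum_left blinfun.scaleR_left sum_distrib_left algebra_simps inner_commute)
    qed
    have fxc: "continuous_on (S \<times> {0..1}) (\<lambda>(x, t). fx x t)"
      unfolding fx_def split_beta
      by (intro continuous_intros cont[OF smooth_on_derivative[OF F]])
    have "((\<lambda>x. integral (cbox 0 1) (\<lambda>t. t ^ m * F (y0 + t *\<^sub>R (x - y0)))) has_derivative
        blinfun_apply (integral (cbox 0 1) (fx x))) (at x within S)"
    proof (rule leibniz_rule[OF _ _ _ x S(2)])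
      fix x t assume xt: "x \<in> S" "t \<in> cbox (0::real) 1"
      then have t: "t \<in> {0..1}" by simp
      have "((\<lambda>x. F (y0 + t *\<^sub>R (x - y0))) has_derivative
          (\<lambda>v. ?F' (y0 + t *\<^sub>R (x - y0)) (t *\<^sub>R v))) (at x)"
        by (rule has_derivative_compose[where f = "\<lambda>x. y0 + t *\<^sub>R (x - y0)", OF _ smooth_on_has_derivative[OF S(1) F seg[OF xt(1) t]]])
          (auto intro!: derivative_eq_intros)
      then have "((\<lambda>x. t ^ m * F (y0 + t *\<^sub>R (x - y0))) has_derivative
          (\<lambda>v. t ^ m * ?F' (y0 + t *\<^sub>R (x - y0)) (t *\<^sub>R v))) (at x)"
        by (rule has_derivative_mult_right)
      moreover have "(\<lambda>v. t ^ m * ?F' (y0 + t *\<^sub>R (x - y0)) (t *\<^sub>R v)) = blinfun_apply (fx x t)"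
      proof
        fix v
        interpret l: bounded_linear "?F' (y0 + t *\<^sub>R (x - y0))"
          using smooth_on_has_derivative[OF S(1) F seg[OF xt(1) t]] by (rule has_derivative_bounded_linear)
        show "t ^ m * ?F' (y0 + t *\<^sub>R (x - y0)) (t *\<^sub>R v) = blinfun_apply (fx x t) v"
          by (simp add: fx[OF xt(1) t] l.scaleR)
      qed
      ultimately show "((\<lambda>x. t ^ m * F (y0 + t *\<^sub>R (x - y0))) has_derivative blinfun_apply (fx x t))
          (at x within S)"
        by (simp add: has_derivative_at_withinI)
    next
      show "(\<lambda>t. t ^ m * F (y0 + t *\<^sub>R (x - y0))) integrable_on cbox 0 1" if "x \<in> S" for x
        using integrable_continuous_real[OF cont1[OF F that]] by simp
    next
      show "continuous_on (S \<times> cbox 0 1) (\<lambda>(x, t). fx x t)" using fxc by simp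
    qed
    moreover have "blinfun_apply (integral (cbox 0 1) (fx x)) = (\<lambda>v. ?I (Suc m) (\<lambda>x. ?F' x v) x)"
    proof
      fix v
      have "continuous_on {0..1} (fx x)"
        using continuous_on_compose2[OF fxc, of "{0..1}" "\<lambda>t. (x, t)"] x
          continuous_on_Pair[OF continuous_on_const continuous_on_id, of "{0..1}" x]
        by auto
      then have "blinfun_apply (integral {0..1} (fx x)) v = integral {0..1} (\<lambda>t. blinfun_apply (fx x t) v)"
        by (intro blinfun_apply_integral integrable_continuous_real)
      also have "\<dots> = ?I (Suc m) (\<lambda>x. ?F' x v) x"
        by (intro integral_cong fx x)
      finally show "blinfun_apply (integral (cbox 0 1) (fx x)) v = ?I (Suc m) (\<lambda>x. ?F' x v) x"
        by simp
    qed
    ultimately show ?thesis using at_within_open[OF x S(1)] by simp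
  qed
  have "Ck_on k S (?I m F)" if "smooth_on S F" for k m F
    using that
  proof (induction k arbitrary: m F)
    case 0
    show ?case
      using der[OF 0] by (auto simp: continuous_on_eq_continuous_at S(1) intro: has_derivative_continuous)
  next
    case (Suc k)
    show ?case
      unfolding Ck_on_Suc_iff[OF S(1)]
      using der[OF Suc.prems] Suc.IH[OF smooth_on_derivative[OF Suc.prems]]
      by (intro exI[of _ "\<lambda>x v. ?I (Suc m) (\<lambda>x. frechet_derivative F (at x) v) x"]) (simp del: power_Suc)
  qed
  with F show ?thesis by (simp add: smooth_on_def)
qed

text \<open>Integrate the derivative of F along the segment from y0 to y: \<open>G b\<close> is the
  mean of the partial derivative in direction b, which is the preceding integral with weight
  exponent 0. This is what later forces a derivation to be determined by its values on
  coordinates.\<close>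

lemma hadamard_lemma:
  fixes F :: "'e::euclidean_space \<Rightarrow> real"
  assumes S: "open S" "convex S" "y0 \<in> S" and F: "smooth_on S F"
  obtains G where "\<And>b. smooth_on S (G b)" "\<And>b. G b y0 = frechet_derivative F (at y0) b"
    "\<And>y. y \<in> S \<Longrightarrow> F y = F y0 + (\<Sum>b\<in>Basis. ((y - y0) \<bullet> b) * G b y)"
proof
  let ?F' = "\<lambda>x. frechet_derivative F (at x)"
  let ?G = "\<lambda>b x. integral {0..1} (\<lambda>t. t ^ 0 * ?F' (y0 + t *\<^sub>R (x - y0)) b)"
  show "smooth_on S (?G b)" for b
    by (rule smooth_on_segment_integral[OF S smooth_on_derivative[OF F]])
  show "?G b y0 = ?F' y0 b" for b by simp
  fix y assume y: "y \<in> S"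
  have seg: "y0 + t *\<^sub>R (y - y0) \<in> S" if "t \<in> {0..1}" for t
    using convexD_alt[OF S(2,3) y, of t] that by (simp add: algebra_simps)
  have cont: "continuous_on {0..1} (\<lambda>t. ?F' (y0 + t *\<^sub>R (y - y0)) b)" for b
    using seg
    by (intro continuous_intros
        continuous_on_compose2[OF smooth_on_continuous[OF S(1) smooth_on_derivative[OF F]]]) auto
  have "((\<lambda>t. F (y0 + t *\<^sub>R (y - y0))) has_vector_derivative
      (\<Sum>b\<in>Basis. ((y - y0) \<bullet> b) * ?F' (y0 + t *\<^sub>R (y - y0)) b)) (at t within {0..1})"
    if t: "t \<in> {0..1}" for t
  proof -
    interpret l: bounded_linear "?F' (y0 + t *\<^sub>R (y - y0))"
      using smooth_on_has_derivative[OF S(1) F seg[OF t]] by (rule has_derivative_bounded_linear)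
    have "((\<lambda>t. F (y0 + t *\<^sub>R (y - y0))) has_derivative
        (\<lambda>s. ?F' (y0 + t *\<^sub>R (y - y0)) (s *\<^sub>R (y - y0)))) (at t within {0..1})"
      by (rule has_derivative_compose[where f = "\<lambda>t. y0 + t *\<^sub>R (y - y0)", OF _ smooth_on_has_derivative[OF S(1) F seg[OF t]]])
        (auto intro!: derivative_eq_intros)
    moreover have "?F' (y0 + t *\<^sub>R (y - y0)) (y - y0)
        = (\<Sum>b\<in>Basis. ((y - y0) \<bullet> b) * ?F' (y0 + t *\<^sub>R (y - y0)) b)"
      by (subst (2) euclidean_representation[symmetric, of "y - y0"]) (simp add: l.sum l.scaleR)
    ultimately show ?thesis by (simp add: has_vector_derivative_def l.scaleR)
  qed
  then have "((\<lambda>t. \<Sum>b\<in>Basis. ((y - y0) \<bullet> b) * ?F' (y0 + t *\<^sub>R (y - y0)) b) has_integral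
      (F (y0 + 1 *\<^sub>R (y - y0)) - F (y0 + 0 *\<^sub>R (y - y0)))) {0..1}"
    by (intro fundamental_theorem_of_calculus) auto
  then have "F y - F y0 = integral {0..1} (\<lambda>t. \<Sum>b\<in>Basis. ((y - y0) \<bullet> b) * ?F' (y0 + t *\<^sub>R (y - y0)) b)"
    by (simp add: integral_unique)
  also have "\<dots> = (\<Sum>b\<in>Basis. ((y - y0) \<bullet> b) * ?G b y)"
    by (subst integral_sum)
      (auto intro!: integrable_continuous_real continuous_intros cont)
  finally show "F y = F y0 + (\<Sum>b\<in>Basis. ((y - y0) \<bullet> b) * ?G b y)" by simp
qed

section \<open>Smooth functions and local frames\<close>

lemma chart_exists:
  assumes "smooth_atlas A"
  obtains U c where "(U, c) \<in> A" "p \<in> U"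
proof -
  have "p \<in> (\<Union>(U, c)\<in>A. U)" using assms by (simp add: smooth_atlas_def)
  then show ?thesis using that by auto
qed

lemma chart_facts:
  assumes "smooth_atlas A" "(U, c) \<in> A"
  shows chart_open: "open U"
    and chart_open_image: "open (c ` U)"
    and chart_continuous: "continuous_on U c"
    and chart_inverse_continuous: "continuous_on (c ` U) (inv_into U c)"
    and chart_inverse: "\<And>q. q \<in> U \<Longrightarrow> inv_into U c (c q) = q"
  using assms unfolding smooth_atlas_def homeomorphism_def by fast+

lemma chart_open_image_Int:
  assumes "smooth_atlas A" "(U, c) \<in> A" "open W"
  shows "open (c ` (U \<inter> W))"
proof -
  note ch = chart_facts[OF assms(1,2)]
  have "c ` (U \<inter> W) = c ` U \<inter> inv_into U c -` W"
    using ch(5) by (auto simp: inv_into_into)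
  then show ?thesis
    using continuous_open_preimage[OF ch(4,2) assms(3)] by simp
qed

lemma smooth_functions_chart:
  assumes "f \<in> smooth_functions A" "(U, c) \<in> A"
  shows "smooth_on (c ` U) (\<lambda>x. f (inv_into U c x))"
  using assms by (auto simp: smooth_functions_def comp_def)

lemma smooth_functionsI:
  assumes "smooth_atlas A"
    and loc: "\<And>U c q. (U, c) \<in> A \<Longrightarrow> q \<in> U \<Longrightarrow>
      \<exists>W g. open W \<and> q \<in> W \<and> smooth_on (c ` (U \<inter> W)) g \<and> (\<forall>r\<in>U \<inter> W. f r = g (c r))"
  shows "f \<in> smooth_functions A"
proof -
  have "smooth_on (c ` U) (f \<circ> inv_into U c)" if Uc: "(U, c) \<in> A" for U c
  proof (rule smooth_on_local)
    note ch = chart_facts[OF assms(1) that]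
    show "open (c ` U)" by (rule ch)
    fix x assume "x \<in> c ` U"
    then obtain q where q: "q \<in> U" "x = c q" by blast
    obtain W g where W: "open W" "q \<in> W" "smooth_on (c ` (U \<inter> W)) g" "\<And>r. r \<in> U \<inter> W \<Longrightarrow> f r = g (c r)"
      using loc[OF Uc q(1)] by blast
    have "open (c ` (U \<inter> W))" by (rule chart_open_image_Int[OF assms(1) that W(1)])
    moreover have "smooth_on (c ` (U \<inter> W)) (f \<circ> inv_into U c)"
      by (rule smooth_on_cong[OF calculation _ W(3)]) (use W(4) ch(5) in auto)
    ultimately show "\<exists>T. open T \<and> x \<in> T \<and> smooth_on T (f \<circ> inv_into U c)"
      using q W(2) by blast
  qed
  then show ?thesis by (auto simp: smooth_functions_def)
qed

section \<open>The ring of smooth functions\<close>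

lemma smooth_functions_const: "smooth_atlas A \<Longrightarrow> (\<lambda>q. k) \<in> smooth_functions A"
  by (auto simp: smooth_functions_def comp_def intro: smooth_on_const chart_open_image)

lemma smooth_functions_add:
  "smooth_atlas A \<Longrightarrow> f \<in> smooth_functions A \<Longrightarrow> g \<in> smooth_functions A \<Longrightarrow>
    (\<lambda>q. f q + g q) \<in> smooth_functions A"
  by (auto simp: smooth_functions_def comp_def intro!: smooth_on_add chart_open_image)

lemma smooth_functions_mult:
  "smooth_atlas A \<Longrightarrow> f \<in> smooth_functions A \<Longrightarrow> g \<in> smooth_functions A \<Longrightarrow>
    (\<lambda>q. f q * g q) \<in> smooth_functions A"
  by (auto simp: smooth_functions_def comp_def intro!: smooth_on_mult chart_open_image)

lemma smooth_functions_diff: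
  "smooth_atlas A \<Longrightarrow> f \<in> smooth_functions A \<Longrightarrow> g \<in> smooth_functions A \<Longrightarrow>
    (\<lambda>q. f q - g q) \<in> smooth_functions A"
  by (auto simp: smooth_functions_def comp_def intro!: smooth_on_diff chart_open_image)

lemma smooth_functions_sum:
  "smooth_atlas A \<Longrightarrow> (\<And>a. a \<in> I \<Longrightarrow> f a \<in> smooth_functions A) \<Longrightarrow>
    (\<lambda>q. \<Sum>a\<in>I. f a q) \<in> smooth_functions A"
  by (induction I rule: infinite_finite_induct)
    (auto intro: smooth_functions_add smooth_functions_const)

text \<open>Near p the factor \<rho> has no zero, so f is a quotient of smooth functions there.
  Frames and linear systems control an unknown function only after such a multiplication, with
  \<rho> depending on p.\<close>

lemma smooth_functions_local_division:
  assumes A: "smooth_atlas A"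
    and loc: "\<And>p. \<exists>\<rho>\<in>smooth_functions A. \<rho> p \<noteq> 0 \<and> (\<lambda>q. \<rho> q * f q) \<in> smooth_functions A"
  shows "f \<in> smooth_functions A"
proof (rule smooth_functionsI[OF A])
  fix U c q assume Uc: "(U, c) \<in> A" and q: "q \<in> U"
  note ch = chart_facts[OF A Uc]
  obtain \<rho> where \<rho>: "\<rho> \<in> smooth_functions A" "\<rho> q \<noteq> 0" "(\<lambda>q. \<rho> q * f q) \<in> smooth_functions A"
    using loc by blast
  let ?\<rho> = "\<lambda>x. \<rho> (inv_into U c x)"
  have sm: "smooth_on (c ` U) ?\<rho>" "smooth_on (c ` U) (\<lambda>x. ?\<rho> x * f (inv_into U c x))"
    using smooth_functions_chart[OF \<rho>(1) Uc] smooth_functions_chart[OF \<rho>(3) Uc] .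
  have "continuous_on U (\<lambda>r. ?\<rho> (c r))"
    using smooth_on_continuous[OF ch(2) sm(1)] ch(3) by (rule continuous_on_compose2) auto
  then have "continuous_on U \<rho>" using ch(5) by (simp cong: continuous_on_cong)
  then have W: "open (U \<inter> \<rho> -` (- {0}))"
    by (rule continuous_open_preimage[OF _ ch(1)]) auto
  let ?W = "U \<inter> \<rho> -` (- {0})"
  have oW: "open (c ` (U \<inter> ?W))" by (rule chart_open_image_Int[OF A Uc W])
  have sub: "c ` (U \<inter> ?W) \<subseteq> c ` U" by blast
  note smW = sm[THEN smooth_on_subset[OF _ ch(2) oW sub]]
  have nz: "?\<rho> x \<noteq> 0" if "x \<in> c ` (U \<inter> ?W)" for x using that ch(5) by auto
  have "smooth_on (c ` (U \<inter> ?W)) (\<lambda>x. inverse (?\<rho> x) * (?\<rho> x * f (inv_into U c x)))"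
    by (rule smooth_on_mult[OF oW smooth_on_inverse[OF oW smW(1) nz] smW(2)])
  moreover have "\<forall>r\<in>U \<inter> ?W. f r = inverse (?\<rho> (c r)) * (?\<rho> (c r) * f (inv_into U c (c r)))"
    using ch(5) by simp
  ultimately show "\<exists>W g. open W \<and> q \<in> W \<and> smooth_on (c ` (U \<inter> W)) g \<and> (\<forall>r\<in>U \<inter> W. f r = g (c r))"
    using W q \<rho>(2) by blast
qed

lemma smooth_functions_compose:
  assumes A: "smooth_atlas A" and B: "smooth_atlas B" and i: "smooth_map A B i"
    and f: "f \<in> smooth_functions B"
  shows "(\<lambda>p. f (i p)) \<in> smooth_functions A"
proof (rule smooth_functionsI[OF A])
  fix U c q assume Uc: "(U, c) \<in> A" and q: "q \<in> U"
  obtain V d where Vd: "(V, d) \<in> B" "i q \<in> V"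
    by (rule chart_exists[OF B])
  note ch = chart_facts[OF A Uc] and ch' = chart_facts[OF B Vd(1)]
  have "continuous_on UNIV i" using i by (simp add: smooth_map_def)
  then have W: "open (i -` V)" using ch'(1) by (simp add: open_vimage)
  have oW: "open (c ` (U \<inter> i -` V))" by (rule chart_open_image_Int[OF A Uc W])
  have "smooth_on (c ` (U \<inter> i -` V)) (\<lambda>x. f (inv_into V d ((d \<circ> i \<circ> inv_into U c) x)))"
  proof (rule smooth_on_compose[OF oW ch'(2)])
    show "smooth_on (c ` (U \<inter> i -` V)) (d \<circ> i \<circ> inv_into U c)"
      using i Uc Vd(1) by (auto simp: smooth_map_def)
    show "smooth_on (d ` V) (\<lambda>x. f (inv_into V d x))" by (rule smooth_functions_chart[OF f Vd(1)])
    show "(d \<circ> i \<circ> inv_into U c) ` c ` (U \<inter> i -` V) \<subseteq> d ` V" using ch(5) by auto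
  qed
  moreover have "\<forall>r\<in>U \<inter> i -` V. f (i r) = f (inv_into V d ((d \<circ> i \<circ> inv_into U c) (c r)))"
    using ch(5) ch'(5) by auto
  ultimately show "\<exists>W g. open W \<and> q \<in> W \<and> smooth_on (c ` (U \<inter> W)) g \<and> (\<forall>r\<in>U \<inter> W. f (i r) = g (c r))"
    using W Vd(2) by (intro exI conjI) auto
qed

text \<open>Two open sets cover the manifold: the chart region over S, where the function is F in
  coordinates, and the complement of the compact set over K, where it is 0. The latter is open
  because compact sets in a Hausdorff space are closed.\<close>

lemma smooth_functions_extension_by_zero:
  assumes A: "smooth_atlas A" and Uc: "(U, c) \<in> A"
    and S: "open S" "S \<subseteq> c ` U" and K: "compact K" "K \<subseteq> S"
    and F: "smooth_on S F" "\<And>x. x \<in> S \<Longrightarrow> x \<notin> K \<Longrightarrow> F x = 0"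
  shows "(\<lambda>q. if q \<in> U \<and> c q \<in> S then F (c q) else 0) \<in> smooth_functions A"
    (is "?f \<in> _")
proof (rule smooth_functionsI[OF A])
  fix V d q assume Vd: "(V, d) \<in> A" and q: "q \<in> V"
  note ch = chart_facts[OF A Uc] and ch' = chart_facts[OF A Vd]
  let ?W = "U \<inter> c -` S"
  have W: "open ?W" by (rule continuous_open_preimage[OF ch(3,1) S(1)])
  show "\<exists>W g. open W \<and> q \<in> W \<and> smooth_on (d ` (V \<inter> W)) g \<and> (\<forall>r\<in>V \<inter> W. ?f r = g (d r))"
  proof (cases "q \<in> ?W")
    case True
    have oVU: "open (d ` (V \<inter> U))" and oVW: "open (d ` (V \<inter> ?W))"
      by (rule chart_open_image_Int[OF A Vd ch(1)], rule chart_open_image_Int[OF A Vd W])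
    have "smooth_on (d ` (V \<inter> U)) (c \<circ> inv_into V d)"
      using A Uc Vd unfolding smooth_atlas_def by blast
    then have "smooth_on (d ` (V \<inter> ?W)) (c \<circ> inv_into V d)"
      by (rule smooth_on_subset[OF _ oVU oVW]) auto
    then have "smooth_on (d ` (V \<inter> ?W)) (\<lambda>x. F ((c \<circ> inv_into V d) x))"
      using ch'(5) by (intro smooth_on_compose[OF oVW S(1) _ F(1)]) (auto simp: comp_def)
    moreover have "\<forall>r\<in>V \<inter> ?W. ?f r = F ((c \<circ> inv_into V d) (d r))"
      using ch'(5) by simp
    ultimately show ?thesis using W True by blast
  next
    case False
    let ?K = "inv_into U c ` K"
    have "compact ?K"
      using K S by (intro compact_continuous_image continuous_on_subset[OF ch(4)]) auto
    then have "open (- ?K)" by (simp add: compact_imp_closed open_Compl)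
    moreover have zero: "\<forall>r\<in>V \<inter> (- ?K). ?f r = 0"
    proof
      fix r assume "r \<in> V \<inter> (- ?K)"
      then have "r \<in> U \<Longrightarrow> c r \<notin> K" using ch(5) by (metis ComplD IntD2 image_eqI)
      then show "?f r = 0" using F(2) by simp
    qed
    moreover have "q \<in> - ?K"
      using False K S ch(5) by (force simp: inv_into_into f_inv_into_f)
    moreover have "smooth_on (d ` (V \<inter> (- ?K))) (\<lambda>x. 0 :: real)"
      by (rule smooth_on_const[OF chart_open_image_Int[OF A Vd calculation(1)]])
    ultimately show ?thesis
      by (intro exI[of _ "- ?K"] exI[of _ "\<lambda>x. 0"]) simp
  qed
qed

section \<open>Tangent vectors as derivations\<close>

context
  fixes A :: "('a::{t2_space,second_countable_topology}, 'e::euclidean_space) atlas" and p v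
  assumes v: "v \<in> tangent_space A p"
begin

lemma tangent_add:
  assumes "f \<in> smooth_functions A" "g \<in> smooth_functions A"
  shows "v (\<lambda>q. f q + g q) = v f + v g"
  using v assms unfolding tangent_space_def plus_fun_def by blast

lemma tangent_scale:
  assumes "f \<in> smooth_functions A"
  shows "v (\<lambda>q. k * f q) = k * v f"
proof -
  have "v (k *\<^sub>R f) = k * v f" using v assms unfolding tangent_space_def by blast
  then show ?thesis by (simp add: scaleR_fun_def)
qed

lemma tangent_mult:
  assumes "f \<in> smooth_functions A" "g \<in> smooth_functions A"
  shows "v (\<lambda>q. f q * g q) = f p * v g + g p * v f"
  using v assms unfolding tangent_space_def times_fun_def by blast

lemma tangent_nonsmooth: "f \<notin> smooth_functions A \<Longrightarrow> v f = 0"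
  using v unfolding tangent_space_def by blast

lemma tangent_const:
  assumes "smooth_atlas A"
  shows "v (\<lambda>q. k) = 0"
proof -
  have "v (\<lambda>q. 1) = 0"
    using tangent_mult[OF smooth_functions_const smooth_functions_const, OF assms assms, of 1 1] by simp
  then show ?thesis
    using tangent_scale[OF smooth_functions_const[OF assms], of k 1] by simp
qed

lemma tangent_sum:
  assumes "smooth_atlas A" "\<And>a. a \<in> I \<Longrightarrow> f a \<in> smooth_functions A"
  shows "v (\<lambda>q. \<Sum>a\<in>I. f a q) = (\<Sum>a\<in>I. v (f a))"
  using assms(2)
proof (induction I rule: infinite_finite_induct)
  case (insert x F)
  then show ?case
    using tangent_add[of "f x" "\<lambda>q. \<Sum>a\<in>F. f a q"] smooth_functions_sum[OF assms(1), of F f]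
    by simp
qed (simp_all add: tangent_const[OF assms(1)])

end

lemma sum_fun_apply: "(\<Sum>a\<in>I. f a) x = (\<Sum>a\<in>I. f a x)"
  by (induction I rule: infinite_finite_induct) auto

text \<open>Derivations act on globally defined functions, so coordinate functions and coordinate
  fields are cut off and extended to the whole manifold. The expansion then holds at every point at
  the price of the factor \<rho>; where \<rho> vanishes, so do the frame fields.\<close>

lemma local_frame:
  fixes A :: "('a::{t2_space,second_countable_topology}, 'e::euclidean_space) atlas" and p :: 'a
  assumes A: "smooth_atlas A"
  obtains \<rho> x and E :: "'e \<Rightarrow> 'a \<Rightarrow> 'a tvec"
  where "\<rho> \<in> smooth_functions A" "\<rho> p = 1"
    "\<And>b. x b \<in> smooth_functions A" "\<And>b. E b \<in> vector_fields A"
    "\<And>q v. v \<in> tangent_space A q \<Longrightarrow> \<rho> q *\<^sub>R v = (\<Sum>b\<in>Basis. v (x b) *\<^sub>R E b q)"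
    "\<And>a b. a \<in> Basis \<Longrightarrow> b \<in> Basis \<Longrightarrow> E a p (x b) = (if a = b then 1 else 0)"
proof -
  obtain U c where Uc: "(U, c) \<in> A" and pU: "p \<in> U"
    by (rule chart_exists[OF A])
  note ch = chart_facts[OF A Uc]
  obtain R where R: "R > 0" "cball (c p) R \<subseteq> c ` U"
    using ch(2) pU open_contains_cball by (metis image_eqI)
  define S where "S = ball (c p) R"
  define K where "K = cball (c p) (3 * R / 4)"
  have S: "open S" "S \<subseteq> c ` U" "convex S" "c p \<in> S" and K: "compact K" "K \<subseteq> S"
    using R by (auto simp: S_def K_def)
  \<comment> \<open>Nested cutoffs: \<beta> is 1 wherever \<kappa> is nonzero, so functions cut off
    by \<beta> agree with their coordinate expressions at every point where \<rho> is nonzero, and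
    both cutoffs vanish off the compact set \<open>K\<close>.\<close>
  have radii: "0 < R / 2" "R / 2 < 3 * R / 4" "0 < R / 4" "R / 4 < R / 2" using R by auto
  obtain \<beta> :: "'e \<Rightarrow> real" where \<beta>: "smooth_on UNIV \<beta>" "\<And>y. y \<in> cball (c p) (R / 2) \<Longrightarrow> \<beta> y = 1"
    "\<And>y. y \<notin> ball (c p) (3 * R / 4) \<Longrightarrow> \<beta> y = 0"
    using smooth_bump_function[OF radii(1,2), of "c p"] by blast
  obtain \<kappa> :: "'e \<Rightarrow> real" where \<kappa>: "smooth_on UNIV \<kappa>" "\<And>y. y \<in> cball (c p) (R / 4) \<Longrightarrow> \<kappa> y = 1"
    "\<And>y. y \<notin> ball (c p) (R / 2) \<Longrightarrow> \<kappa> y = 0"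
    using smooth_bump_function[OF radii(3,4), of "c p"] by blast
  define ext where "ext F q = (if q \<in> U \<and> c q \<in> S then F (c q) else 0)" for F :: "'e \<Rightarrow> real" and q
  have \<beta>0: "\<beta> y = 0" and \<kappa>0: "\<kappa> y = 0" if "y \<notin> K" for y
    using that \<beta>(3) \<kappa>(3) R unfolding K_def by auto
  have sm: "smooth_on S \<beta>" "smooth_on S \<kappa>"
    using \<beta>(1) \<kappa>(1) S(1) by (auto intro: smooth_on_subset)
  have ext: "ext (\<lambda>y. \<beta> y * F y) \<in> smooth_functions A" "ext (\<lambda>y. \<kappa> y * F y) \<in> smooth_functions A"
    if "smooth_on S F" for F
    unfolding ext_def using \<beta>0 \<kappa>0
    by (auto intro!: smooth_functions_extension_by_zero[OF A Uc S(1,2) K] smooth_on_mult[OF S(1)] sm that)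
  define \<rho> where "\<rho> = ext \<kappa>"
  define x where "x b = ext (\<lambda>y. \<beta> y * (y \<bullet> b))" for b
  define E where "E b q f = (if f \<in> smooth_functions A then
      ext (\<lambda>y. \<kappa> y * frechet_derivative (\<lambda>y. f (inv_into U c y)) (at y) b) q else 0)" for b q f
  have \<rho>: "\<rho> \<in> smooth_functions A"
    using ext(2)[OF smooth_on_const[OF S(1), of 1]] by (simp add: \<rho>_def)
  have \<rho>p: "\<rho> p = 1" using \<kappa>(2) R S(4) pU by (simp add: \<rho>_def ext_def)
  have x: "x b \<in> smooth_functions A" for b
    unfolding x_def by (intro ext smooth_on_bounded_linear bounded_linear_inner_left S)
  have E_def': "E b q f = \<rho> q * frechet_derivative (\<lambda>y. f (inv_into U c y)) (at (c q)) b"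
    if "f \<in> smooth_functions A" for b q f
    using that by (simp add: E_def \<rho>_def ext_def)
  have fS: "smooth_on S (\<lambda>y. f (inv_into U c y))" if "f \<in> smooth_functions A" for f
    by (rule smooth_on_subset[OF smooth_functions_chart[OF that Uc] ch(2) S(1,2)])
  have chart_pt: "q \<in> U" "c q \<in> S" "c q \<in> ball (c p) (R / 2)" if "\<rho> q \<noteq> 0" for q
  proof -
    show q: "q \<in> U" "c q \<in> S" using that by (auto simp: \<rho>_def ext_def split: if_splits)
    have "\<kappa> (c q) \<noteq> 0" using that q by (simp add: \<rho>_def ext_def)
    with \<kappa>(3) show "c q \<in> ball (c p) (R / 2)" by blast
  qed
  have E_tangent: "E b q \<in> tangent_space A q" for b q
  proof (cases "\<rho> q = 0")
    case True
    then have "E b q = (\<lambda>f. 0)" using E_def' by (auto simp: E_def fun_eq_iff)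
    then show ?thesis by (simp add: tangent_space_def)
  next
    case False
    note cq = chart_pt[OF False]
    have D: "((\<lambda>y. f (inv_into U c y)) has_derivative
        frechet_derivative (\<lambda>y. f (inv_into U c y)) (at (c q))) (at (c q))"
      if "f \<in> smooth_functions A" for f
      by (rule smooth_on_has_derivative[OF S(1) fS[OF that] cq(2)])
    have "E b q (f + g) = E b q f + E b q g" if "f \<in> smooth_functions A" "g \<in> smooth_functions A" for f g
      using frechet_derivative_at[OF has_derivative_add[OF D D, OF that], symmetric]
        smooth_functions_add[OF A that]
      by (simp add: E_def' that plus_fun_def algebra_simps)
    moreover have "E b q (k *\<^sub>R f) = k * E b q f" if "f \<in> smooth_functions A" for f k
      using frechet_derivative_at[OF has_derivative_mult_right[OF D[OF that], of k], symmetric]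
        smooth_functions_mult[OF A smooth_functions_const[OF A] that, of k]
      by (simp add: E_def' that scaleR_fun_def)
    moreover have "E b q (f * g) = f q * E b q g + g q * E b q f"
      if "f \<in> smooth_functions A" "g \<in> smooth_functions A" for f g
      using frechet_derivative_at[OF has_derivative_mult[OF D D, OF that], symmetric]
        smooth_functions_mult[OF A that]
      by (simp add: E_def' that times_fun_def algebra_simps ch(5)[OF cq(1)])
    moreover have "E b q f = 0" if "f \<notin> smooth_functions A" for f using that by (simp add: E_def)
    ultimately show ?thesis by (simp add: tangent_space_def)
  qed
  have "(\<lambda>q. E b q f) \<in> smooth_functions A" if "f \<in> smooth_functions A" for b f
    using ext(2)[OF smooth_on_derivative[OF fS[OF that]]] that by (simp add: E_def)
  then have E: "E b \<in> vector_fields A" for b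
    using E_tangent by (simp add: vector_fields_def sections_along_def)
  have frame: "\<rho> q *\<^sub>R v = (\<Sum>b\<in>Basis. v (x b) *\<^sub>R E b q)" if v: "v \<in> tangent_space A q" for q v
  proof
    fix f
    show "(\<rho> q *\<^sub>R v) f = (\<Sum>b\<in>Basis. v (x b) *\<^sub>R E b q) f"
    proof (cases "f \<in> smooth_functions A \<and> \<rho> q \<noteq> 0")
      case False
      then have "E b q f = 0" for b using E_def'[of f b q] by (cases "f \<in> smooth_functions A") (auto simp: E_def)
      moreover have "\<rho> q * v f = 0" using False tangent_nonsmooth[OF v, of f] by auto
      ultimately show ?thesis by (simp add: scaleR_fun_def sum_fun_apply)
    next
      case True
      then have f: "f \<in> smooth_functions A" and "\<rho> q \<noteq> 0" by auto
      note cq = chart_pt[OF \<open>\<rho> q \<noteq> 0\<close>]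
      let ?F = "\<lambda>y. f (inv_into U c y)"
      obtain G where G: "\<And>b. smooth_on S (G b)" "\<And>b. G b (c q) = frechet_derivative ?F (at (c q)) b"
        "\<And>y. y \<in> S \<Longrightarrow> ?F y = ?F (c q) + (\<Sum>b\<in>Basis. ((y - c q) \<bullet> b) * G b y)"
        using hadamard_lemma[OF S(1,3) cq(2) fS[OF f]] by blast
      define G' where "G' b = ext (\<lambda>y. \<beta> y * G b y)" for b
      have G': "G' b \<in> smooth_functions A" for b
        unfolding G'_def by (intro ext G)
      have xc: "x b r = c r \<bullet> b" "G' b r = G b (c r)" if "\<rho> r \<noteq> 0" for b r
        using chart_pt[OF that] \<beta>(2)[of "c r"] by (simp_all add: x_def G'_def ext_def)
      \<comment> \<open>Hadamard's expansion of f at q with globally extended ingredients. It is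
        known to equal f only where \<rho> is nonzero, hence the comparison of \<rho> f with \<rho>
        H. As f and H agree at q, the terms containing \<open>v \<rho>\<close> cancel in the Leibniz
        rule.\<close>
      let ?H = "\<lambda>r. f q + (\<Sum>b\<in>Basis. (x b r + - x b q) * G' b r)"
      have "\<rho> r * f r = \<rho> r * ?H r" for r
      proof (cases "\<rho> r = 0")
        case False
        then show ?thesis
          using G(3)[OF chart_pt(2)[OF False]] ch(5)[OF chart_pt(1)[OF False]] ch(5)[OF cq(1)]
          by (simp add: xc True inner_diff_left)
      qed simp
      then have "v (\<lambda>r. \<rho> r * f r) = v (\<lambda>r. \<rho> r * ?H r)" by presburger
      moreover have H: "?H \<in> smooth_functions A"
        by (intro smooth_functions_add smooth_functions_const smooth_functions_sum smooth_functions_mult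
            x G' A)
      moreover have "v ?H = (\<Sum>b\<in>Basis. G' b q * v (x b))"
      proof -
        have xx: "(\<lambda>r. x b r + - x b q) \<in> smooth_functions A" for b
          by (intro smooth_functions_add smooth_functions_const x A)
        have "v ?H = v (\<lambda>r. f q) + v (\<lambda>r. \<Sum>b\<in>Basis. (x b r + - x b q) * G' b r)"
          by (intro tangent_add[OF v] smooth_functions_const smooth_functions_sum smooth_functions_mult
              xx G' A)
        also have "\<dots> = (\<Sum>b\<in>Basis. v (\<lambda>r. (x b r + - x b q) * G' b r))"
          using tangent_sum[OF v A smooth_functions_mult[OF A xx G']] by (simp add: tangent_const[OF v A])
        also have "\<dots> = (\<Sum>b\<in>Basis. G' b q * v (x b))"
          unfolding tangent_mult[OF v xx G'] tangent_add[OF v x smooth_functions_const[OF A]]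
            tangent_const[OF v A] by simp
        finally show ?thesis .
      qed
      ultimately have "\<rho> q * v f = \<rho> q * (\<Sum>b\<in>Basis. G' b q * v (x b))"
        using tangent_mult[OF v \<rho> f] tangent_mult[OF v \<rho> H] by simp
      then show ?thesis
        using True by (simp add: scaleR_fun_def sum_fun_apply E_def' f xc G(2) sum_distrib_left mult_ac)
    qed
  qed
  have "E a p (x b) = (if a = b then 1 else 0)" if ab: "a \<in> Basis" "b \<in> Basis" for a b
  proof -
    have "((\<lambda>y. x b (inv_into U c y)) has_derivative (\<lambda>v. v \<bullet> b)) (at (c p))"
    proof (rule has_derivative_transform_within_open[OF _ open_ball])
      show "((\<lambda>y. y \<bullet> b) has_derivative (\<lambda>v. v \<bullet> b)) (at (c p))"
        by (intro bounded_linear_imp_has_derivative bounded_linear_inner_left)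
      show "c p \<in> ball (c p) (R / 2)" using R by simp
      fix y assume y: "y \<in> ball (c p) (R / 2)"
      then have "y \<in> S" using R by (simp add: S_def)
      then show "y \<bullet> b = x b (inv_into U c y)"
        using y S(2) \<beta>(2)[of y] by (force simp: x_def ext_def ch(5))
    qed
    then have "frechet_derivative (\<lambda>y. x b (inv_into U c y)) (at (c p)) = (\<lambda>v. v \<bullet> b)"
      by (rule frechet_derivative_at[symmetric])
    then show ?thesis using ab by (simp add: E_def' x \<rho>p inner_Basis)
  qed
  with \<rho> \<rho>p x E frame show ?thesis by (rule that)
qed

section \<open>Sections along a map\<close>

lemma additive_on_subspace_sum:
  fixes T :: "'v::real_vector \<Rightarrow> 'w::real_vector"
  assumes S: "subspace S" and add: "\<And>u v. u \<in> S \<Longrightarrow> v \<in> S \<Longrightarrow> T (u + v) = T u + T v"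
    and f: "\<And>a. a \<in> I \<Longrightarrow> f a \<in> S"
  shows "T (\<Sum>a\<in>I. f a) = (\<Sum>a\<in>I. T (f a))"
proof -
  have 0: "T 0 = 0" using add[OF subspace_0[OF S] subspace_0[OF S]] by simp
  show ?thesis
    using f
  proof (induction I rule: infinite_finite_induct)
    case (insert x F)
    then show ?case using add[of "f x" "sum f F"] subspace_sum[OF S, of F f] by simp
  qed (simp_all add: 0)
qed

lemma scaleR_fun_apply: "(k *\<^sub>R f) x = k *\<^sub>R f x"
  by (simp add: scaleR_fun_def)

lemma subspace_tangent_space: "smooth_atlas A \<Longrightarrow> subspace (tangent_space A p)"
  unfolding subspace_def
  by (auto simp: tangent_space_def scaleR_fun_def zero_fun_def plus_fun_def algebra_simps)

lemmas tangent_space_add = subspace_add[OF subspace_tangent_space]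
  and tangent_space_scale = subspace_scale[OF subspace_tangent_space]
  and tangent_space_diff = subspace_diff[OF subspace_tangent_space]
  and tangent_space_sum = subspace_sum[OF subspace_tangent_space]
  and tangent_space_0 = subspace_0[OF subspace_tangent_space]

lemma section_tangent: "V \<in> sections_along A B i \<Longrightarrow> V p \<in> tangent_space B (i p)"
  and section_smooth: "V \<in> sections_along A B i \<Longrightarrow> f \<in> smooth_functions B \<Longrightarrow>
    (\<lambda>p. V p f) \<in> smooth_functions A"
  by (auto simp: sections_along_def)

lemma vector_field_tangent: "X \<in> vector_fields A \<Longrightarrow> X p \<in> tangent_space A p"
  and vector_field_smooth: "X \<in> vector_fields A \<Longrightarrow> f \<in> smooth_functions A \<Longrightarrow>
    (\<lambda>p. X p f) \<in> smooth_functions A"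
  by (auto simp: vector_fields_def sections_along_def)

context
  fixes A :: "('b::{t2_space,second_countable_topology}, 'f::euclidean_space) atlas"
    and B :: "('a::{t2_space,second_countable_topology}, 'e::euclidean_space) atlas"
  assumes A: "smooth_atlas A" and B: "smooth_atlas B"
begin

lemma sections_add:
  assumes "V \<in> sections_along A B i" "W \<in> sections_along A B i"
  shows "V + W \<in> sections_along A B i"
  using assms by (auto simp: sections_along_def plus_fun_def intro!: smooth_functions_add[OF A]
      intro: tangent_space_add[OF B, unfolded plus_fun_def])

lemma sections_scale:
  assumes "f \<in> smooth_functions A" "V \<in> sections_along A B i"
  shows "(\<lambda>q. f q *\<^sub>R V q) \<in> sections_along A B i"
proof -
  have "(\<lambda>q. (f q *\<^sub>R V q) h) \<in> smooth_functions A" if "h \<in> smooth_functions B" for h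
    using smooth_functions_mult[OF A assms(1) section_smooth[OF assms(2) that]]
    by (simp add: scaleR_fun_def)
  then show ?thesis
    using section_tangent[OF assms(2)] tangent_space_scale[OF B] by (simp add: sections_along_def)
qed

lemma sections_zero: "0 \<in> sections_along A B i"
  using tangent_space_0[OF B] smooth_functions_const[OF A, of 0]
  by (simp add: sections_along_def zero_fun_def)

lemma sections_const_scale:
  assumes "V \<in> sections_along A B i"
  shows "k *\<^sub>R V \<in> sections_along A B i"
  using sections_scale[OF smooth_functions_const[OF A] assms, of k] by (simp add: scaleR_fun_def)

lemma subspace_sections: "subspace (sections_along A B i)"
  using sections_add sections_const_scale sections_zero by (simp add: subspace_def)

lemmas sections_sum = subspace_sum[OF subspace_sections]
  and sections_diff = subspace_diff[OF subspace_sections]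

end

lemma lie_bracket_vector_field:
  assumes A: "smooth_atlas A" and X: "X \<in> vector_fields A" and Y: "Y \<in> vector_fields A"
  shows "lie_bracket X Y \<in> vector_fields A"
proof -
  note t = vector_field_tangent[OF X] vector_field_tangent[OF Y]
  note s = vector_field_smooth[OF X] vector_field_smooth[OF Y]
  have "lie_bracket X Y p \<in> tangent_space A p" for p
  proof -
    have "lie_bracket X Y p (f + g) = lie_bracket X Y p f + lie_bracket X Y p g"
      if "f \<in> smooth_functions A" "g \<in> smooth_functions A" for f g
      unfolding lie_bracket_def plus_fun_def
      by (simp add: tangent_add[OF t(1)] tangent_add[OF t(2)] s that)
    moreover have "lie_bracket X Y p (k *\<^sub>R f) = k * lie_bracket X Y p f"
      if "f \<in> smooth_functions A" for f k
      unfolding lie_bracket_def scaleR_fun_def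
      by (simp add: tangent_scale[OF t(1)] tangent_scale[OF t(2)] s that right_diff_distrib)
    moreover have "lie_bracket X Y p (f * g) = f p * lie_bracket X Y p g + g p * lie_bracket X Y p f"
      if "f \<in> smooth_functions A" "g \<in> smooth_functions A" for f g
      unfolding lie_bracket_def times_fun_def
      by (simp add: tangent_mult[OF t(1)] tangent_mult[OF t(2)] tangent_add[OF t(1)]
          tangent_add[OF t(2)] smooth_functions_mult[OF A] s that algebra_simps)
    \<comment> \<open>The normalisation of derivations: for nonsmooth f both inner functions are
      constantly 0, and derivations kill constants.\<close>
    moreover have "lie_bracket X Y p f = 0" if "f \<notin> smooth_functions A" for f
      unfolding lie_bracket_def
      by (simp add: tangent_nonsmooth[OF t(1) that] tangent_nonsmooth[OF t(2) that]
          tangent_const[OF t(1) A] tangent_const[OF t(2) A])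
    ultimately show ?thesis by (simp add: tangent_space_def)
  qed
  moreover have "(\<lambda>p. lie_bracket X Y p f) \<in> smooth_functions A" if "f \<in> smooth_functions A" for f
    unfolding lie_bracket_def by (intro smooth_functions_diff[OF A] s that)
  ultimately show ?thesis by (simp add: vector_fields_def sections_along_def)
qed

text \<open>Freezing the frame coefficients of v at p gives a global field, and
  \<open>\<rho> p = 1\<close> makes its value there exactly v.\<close>

lemma vector_field_extension:
  fixes A :: "('a::{t2_space,second_countable_topology}, 'e::euclidean_space) atlas"
  assumes A: "smooth_atlas A" and v: "v \<in> tangent_space A p"
  obtains X where "X \<in> vector_fields A" "X p = v"
proof -
  obtain \<rho> x and E :: "'e \<Rightarrow> 'a \<Rightarrow> 'a tvec" where fr: "\<rho> \<in> smooth_functions A" "\<rho> p = 1"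
    "\<And>b. x b \<in> smooth_functions A" "\<And>b. E b \<in> vector_fields A"
    "\<And>q v. v \<in> tangent_space A q \<Longrightarrow> \<rho> q *\<^sub>R v = (\<Sum>b\<in>Basis. v (x b) *\<^sub>R E b q)"
    "\<And>a b. a \<in> Basis \<Longrightarrow> b \<in> Basis \<Longrightarrow> E a p (x b) = (if a = b then 1 else 0)"
    by (rule local_frame[OF A, of p]) (rule that)
  have "(\<Sum>b\<in>Basis. v (x b) *\<^sub>R E b) \<in> vector_fields A"
    unfolding vector_fields_def
    by (intro sections_sum[OF A A] sections_const_scale[OF A A] fr(4)[unfolded vector_fields_def])
  moreover have "(\<Sum>b\<in>Basis. v (x b) *\<^sub>R E b) p = v"
    unfolding sum_fun_apply scaleR_fun_apply fr(5)[OF v, symmetric] by (simp add: fr(2))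
  ultimately show ?thesis by (rule that)
qed

text \<open>Proved by Gaussian elimination without division over the ring of smooth functions.\<close>

lemma smooth_linear_system:
  assumes A: "smooth_atlas A" and I: "finite I"
    and J: "\<And>k a. k \<in> N \<Longrightarrow> a \<in> I \<Longrightarrow> J k a \<in> smooth_functions A"
    and rhs: "\<And>k. k \<in> N \<Longrightarrow> (\<lambda>q. \<Sum>a\<in>I. J k a q * s a q) \<in> smooth_functions A"
    and inj: "\<And>l. (\<And>k. k \<in> N \<Longrightarrow> (\<Sum>a\<in>I. l a * J k a p) = 0) \<Longrightarrow> (\<forall>a\<in>I. l a = (0::real))"
  shows "\<exists>\<rho>\<in>smooth_functions A. \<rho> p \<noteq> 0 \<and> (\<forall>a\<in>I. (\<lambda>q. \<rho> q * s a q) \<in> smooth_functions A)"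
  using I J rhs inj
proof (induction I arbitrary: J rule: finite_induct)
  case empty
  show ?case using smooth_functions_const[OF A, of 1] by (intro bexI[of _ "\<lambda>q. 1"]) auto
next
  case (insert a0 I)
  note J = insert.prems(1) and rhs = insert.prems(2) and inj = insert.prems(3)
  \<comment> \<open>The pivot: if there were none, the indicator of \<open>a0\<close> would be a
    nontrivial relation between the columns at p.\<close>
  have "\<exists>k0\<in>N. J k0 a0 p \<noteq> 0"
  proof (rule ccontr)
    assume "\<not> ?thesis"
    then have "\<forall>a\<in>insert a0 I. (if a = a0 then 1 else 0) = (0::real)"
      using insert.hyps by (intro inj) (auto simp: if_distrib[of "\<lambda>x. x * _"] cong: if_cong)
    then show False by simp
  qed
  then obtain k0 where k0: "k0 \<in> N" "J k0 a0 p \<noteq> 0" by blast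
  \<comment> \<open>Cross-multiplication with the pivot row eliminates the unknown belonging to
    \<open>a0\<close>.\<close>
  define J' where "J' k a = (\<lambda>q. J k0 a0 q * J k a q - J k a0 q * J k0 a q)" for k a
  have "\<exists>\<rho>\<in>smooth_functions A. \<rho> p \<noteq> 0 \<and> (\<forall>a\<in>I. (\<lambda>q. \<rho> q * s a q) \<in> smooth_functions A)"
  proof (rule insert.IH)
    show "J' k a \<in> smooth_functions A" if "k \<in> N" "a \<in> I" for k a
      unfolding J'_def using that k0(1)
      by (intro smooth_functions_diff smooth_functions_mult A J) auto
    show "(\<lambda>q. \<Sum>a\<in>I. J' k a q * s a q) \<in> smooth_functions A" if k: "k \<in> N" for k
    proof -
      have "(\<Sum>a\<in>I. J' k a q * s a q) = J k0 a0 q * (\<Sum>a\<in>insert a0 I. J k a q * s a q)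
          - J k a0 q * (\<Sum>a\<in>insert a0 I. J k0 a q * s a q)" for q
        using insert.hyps
        by (simp add: J'_def algebra_simps sum_distrib_left sum_subtractf)
      then show ?thesis
        using k k0(1) by (simp only:) (intro smooth_functions_diff smooth_functions_mult A J rhs; simp)
    qed
    fix l assume l: "\<And>k. k \<in> N \<Longrightarrow> (\<Sum>a\<in>I. l a * J' k a p) = 0"
    \<comment> \<open>Lifts a relation between the reduced columns to one between the original
      columns: the given coefficients are scaled by the pivot, and the one at \<open>a0\<close>
      absorbs the pivot row.\<close>
    let ?l = "\<lambda>a. if a = a0 then - (\<Sum>a\<in>I. l a * J k0 a p) else J k0 a0 p * l a"
    have "\<forall>a\<in>insert a0 I. ?l a = 0"
    proof (rule inj)
      fix k assume k: "k \<in> N"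
      have "(\<Sum>a\<in>I. ?l a * J k a p) = (\<Sum>a\<in>I. J k0 a0 p * l a * J k a p)"
        using insert.hyps by (intro sum.cong) auto
      then have "(\<Sum>a\<in>insert a0 I. ?l a * J k a p) = (\<Sum>a\<in>I. l a * J' k a p)"
        using insert.hyps
        by (simp add: J'_def algebra_simps sum_distrib_left sum_subtractf)
      then show "(\<Sum>a\<in>insert a0 I. ?l a * J k a p) = 0" using l[OF k] by simp
    qed
    then show "\<forall>a\<in>I. l a = 0" using k0(2) insert.hyps by (metis insertCI mult_eq_0_iff)
  qed
  then obtain \<rho> where \<rho>: "\<rho> \<in> smooth_functions A" "\<rho> p \<noteq> 0"
    "\<And>a. a \<in> I \<Longrightarrow> (\<lambda>q. \<rho> q * s a q) \<in> smooth_functions A" by blast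
  let ?\<rho> = "\<lambda>q. J k0 a0 q * \<rho> q"
  have J0: "J k0 a0 \<in> smooth_functions A" using J k0(1) by blast
  \<comment> \<open>Back substitution: row \<open>k0\<close> multiplied by \<rho> expresses the
    remaining unknown, times pivot and \<rho>, through functions already known to be smooth.\<close>
  have "(\<lambda>q. \<rho> q * (\<Sum>a\<in>insert a0 I. J k0 a q * s a q) - (\<Sum>a\<in>I. J k0 a q * (\<rho> q * s a q)))
      \<in> smooth_functions A"
    using k0(1) by (intro smooth_functions_diff smooth_functions_mult smooth_functions_sum A J rhs \<rho>) auto
  then have "(\<lambda>q. ?\<rho> q * s a0 q) \<in> smooth_functions A"
    using insert.hyps by (simp add: algebra_simps sum_distrib_left)
  moreover have "(\<lambda>q. ?\<rho> q * s a q) \<in> smooth_functions A" if "a \<in> I" for a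
    using smooth_functions_mult[OF A J0 \<rho>(3)[OF that]] by (simp add: mult.assoc)
  ultimately show ?case
    using smooth_functions_mult[OF A J0 \<rho>(1)] \<rho>(2) k0(2) by (intro bexI[of _ ?\<rho>]) auto
qed

lemma differential_tangent:
  assumes "smooth_atlas A" "smooth_atlas B" "smooth_map A B i" "u \<in> tangent_space A p"
  shows "differential B i u \<in> tangent_space B (i p)"
proof -
  have c: "(\<lambda>q. f (i q)) \<in> smooth_functions A" if "f \<in> smooth_functions B" for f
    by (rule smooth_functions_compose[OF assms(1-3) that])
  show ?thesis
    unfolding tangent_space_def differential_def comp_def plus_fun_def times_fun_def scaleR_fun_def
    using tangent_add[OF assms(4) c c] tangent_mult[OF assms(4) c c] tangent_scale[OF assms(4) c]
      smooth_functions_add[OF assms(2)] smooth_functions_mult[OF assms(2)]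
      smooth_functions_mult[OF assms(2) smooth_functions_const[OF assms(2)]]
    by auto
qed

lemma differential_apply: "f \<in> smooth_functions B \<Longrightarrow> differential B i u f = u (\<lambda>q. f (i q))"
  by (simp add: differential_def comp_def)

lemma linear_differential: "linear (differential B i)"
  by (rule linearI) (auto simp: differential_def scaleR_fun_def fun_eq_iff)

lemmas differential_add = linear_add[OF linear_differential]
  and differential_diff = linear_diff[OF linear_differential]
  and differential_scale = linear_scale[OF linear_differential]
  and differential_0 = linear_0[OF linear_differential]

section \<open>Connections along a map\<close>

locale pulled_back_connection =
  fixes A :: "('b::{t2_space,second_countable_topology}, 'f::euclidean_space) atlas"
    and B :: "('a::{t2_space,second_countable_topology}, 'e::euclidean_space) atlas"
    and i :: "'b \<Rightarrow> 'a"
    and nabbar :: "('a, 'a tvec) connection"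
    and D :: "('b, 'a tvec) connection"
  assumes A: "smooth_atlas A" and B: "smooth_atlas B" and i: "smooth_map A B i"
    and pullback: "pullback_connection A B i nabbar D"
begin

abbreviation "\<Gamma> \<equiv> sections_along A B i"
abbreviation "di \<equiv> differential B i"

lemmas comp_smooth = smooth_functions_compose[OF A B i]
lemmas di_tangent = differential_tangent[OF A B i]

lemma pushforward_section:
  assumes "X \<in> vector_fields A"
  shows "(\<lambda>q. di (X q)) \<in> \<Gamma>"
  using di_tangent[OF vector_field_tangent[OF assms]] vector_field_smooth[OF assms comp_smooth]
  by (simp add: sections_along_def differential_apply)

lemma restriction_section:
  assumes "W \<in> vector_fields B"
  shows "(\<lambda>q. W (i q)) \<in> \<Gamma>"
  using vector_field_tangent[OF assms] comp_smooth[OF vector_field_smooth[OF assms]]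
  by (simp add: sections_along_def)

lemma connection: "connection_along A B i D"
  using pullback by (simp add: pullback_connection_def)

lemma D_restriction:
  assumes "W \<in> vector_fields B" "u \<in> tangent_space A p"
  shows "D p u (\<lambda>q. W (i q)) = nabbar (i p) (di u) W"
  using pullback assms unfolding pullback_connection_def comp_def by blast

context
  fixes p u assumes u: "u \<in> tangent_space A p"
begin

lemma D_tangent: "V \<in> \<Gamma> \<Longrightarrow> D p u V \<in> tangent_space B (i p)"
  using connection u unfolding connection_along_def by blast

lemma D_add: "V \<in> \<Gamma> \<Longrightarrow> W \<in> \<Gamma> \<Longrightarrow> D p u (V + W) = D p u V + D p u W"
  using connection u unfolding connection_along_def by blast

lemma D_scale:
  "f \<in> smooth_functions A \<Longrightarrow> V \<in> \<Gamma> \<Longrightarrow>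
    D p u (\<lambda>q. f q *\<^sub>R V q) = u f *\<^sub>R V p + f p *\<^sub>R D p u V"
  using connection u unfolding connection_along_def by blast

lemma D_zero: "D p u 0 = 0"
  using D_add[OF sections_zero[OF A B] sections_zero[OF A B]] by simp

lemma D_sum:
  assumes "\<And>a. a \<in> I \<Longrightarrow> V a \<in> \<Gamma>"
  shows "D p u (\<Sum>a\<in>I. V a) = (\<Sum>a\<in>I. D p u (V a))"
  by (rule additive_on_subspace_sum[OF subspace_sections[OF A B] D_add assms])

text \<open>A section along \<open>i\<close> is in general not the restriction of an ambient field,
  but after multiplication by the cutoff of a local frame it is a combination of such restrictions
  with smooth coefficients on M. Linearity over these coefficients at p reduces T to restrictions,
  and the cutoff equals 1 at i p.\<close>

lemma tensorial_vanishing: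
  fixes T :: "('b \<Rightarrow> 'a tvec) \<Rightarrow> 'c::real_vector"
  assumes add: "\<And>V W. V \<in> \<Gamma> \<Longrightarrow> W \<in> \<Gamma> \<Longrightarrow> T (V + W) = T V + T W"
    and scale: "\<And>f V. f \<in> smooth_functions A \<Longrightarrow> V \<in> \<Gamma> \<Longrightarrow> T (\<lambda>q. f q *\<^sub>R V q) = f p *\<^sub>R T V"
    and restr: "\<And>W. W \<in> vector_fields B \<Longrightarrow> T (\<lambda>q. W (i q)) = 0"
    and V: "V \<in> \<Gamma>"
  shows "T V = 0"
proof -
  obtain \<rho> y and W :: "'e \<Rightarrow> 'a \<Rightarrow> 'a tvec" where fr: "\<rho> \<in> smooth_functions B" "\<rho> (i p) = 1"
    "\<And>b. y b \<in> smooth_functions B" "\<And>b. W b \<in> vector_fields B"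
    "\<And>q v. v \<in> tangent_space B q \<Longrightarrow> \<rho> q *\<^sub>R v = (\<Sum>b\<in>Basis. v (y b) *\<^sub>R W b q)"
    "\<And>a b. a \<in> Basis \<Longrightarrow> b \<in> Basis \<Longrightarrow> W a (i p) (y b) = (if a = b then 1 else 0)"
    by (rule local_frame[OF B, of "i p"]) (rule that)
  have Wy: "(\<lambda>q. V q (y b) *\<^sub>R W b (i q)) \<in> \<Gamma>" for b
    by (rule sections_scale[OF A B section_smooth[OF V fr(3)] restriction_section[OF fr(4)]])
  have "(\<lambda>q. \<rho> (i q) *\<^sub>R V q) = (\<Sum>b\<in>Basis. (\<lambda>q. V q (y b) *\<^sub>R W b (i q)))"
    using fr(5)[OF section_tangent[OF V]] by (auto simp: sum_fun_apply)
  then have "\<rho> (i p) *\<^sub>R T V = T (\<Sum>b\<in>Basis. (\<lambda>q. V q (y b) *\<^sub>R W b (i q)))"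
    using scale[OF comp_smooth[OF fr(1)] V] by simp
  also have "\<dots> = (\<Sum>b\<in>Basis. T (\<lambda>q. V q (y b) *\<^sub>R W b (i q)))"
    by (rule additive_on_subspace_sum[of "\<Gamma>" T Basis "\<lambda>b q. V q (y b) *\<^sub>R W b (i q)",
          OF subspace_sections[OF A B] add Wy])
  also have "\<dots> = (\<Sum>b\<in>Basis. V p (y b) *\<^sub>R T (\<lambda>q. W b (i q)))"
    by (simp add: scale[OF section_smooth[OF V fr(3)] restriction_section[OF fr(4)]])
  finally show ?thesis by (simp add: fr(2) restr[OF fr(4)])
qed

end

text \<open>The same frame expansion, now read at all points at once: it shows smoothness of the
  value times a cutoff, which \<open>smooth_functions_local_division\<close> removes. It serves for
  the metric and for the components of \<phi>.\<close>

lemma smooth_pairing: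
  assumes add: "\<And>q u v. u \<in> tangent_space B (i q) \<Longrightarrow> v \<in> tangent_space B (i q) \<Longrightarrow> T q (u + v) = T q u + T q v"
    and scale: "\<And>q c v. v \<in> tangent_space B (i q) \<Longrightarrow> T q (c *\<^sub>R v) = c * T q v"
    and restr: "\<And>W. W \<in> vector_fields B \<Longrightarrow> (\<lambda>q. T q (W (i q))) \<in> smooth_functions A"
    and V: "V \<in> \<Gamma>"
  shows "(\<lambda>q. T q (V q) :: real) \<in> smooth_functions A"
proof (rule smooth_functions_local_division[OF A])
  fix p
  obtain \<rho> y and W :: "'e \<Rightarrow> 'a \<Rightarrow> 'a tvec" where fr: "\<rho> \<in> smooth_functions B" "\<rho> (i p) = 1"
    "\<And>b. y b \<in> smooth_functions B" "\<And>b. W b \<in> vector_fields B"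
    "\<And>q v. v \<in> tangent_space B q \<Longrightarrow> \<rho> q *\<^sub>R v = (\<Sum>b\<in>Basis. v (y b) *\<^sub>R W b q)"
    "\<And>a b. a \<in> Basis \<Longrightarrow> b \<in> Basis \<Longrightarrow> W a (i p) (y b) = (if a = b then 1 else 0)"
    by (rule local_frame[OF B, of "i p"]) (rule that)
  have "\<rho> (i q) * T q (V q) = (\<Sum>b\<in>Basis. V q (y b) * T q (W b (i q)))" for q
  proof -
    note t = vector_field_tangent[OF fr(4)]
    have "\<rho> (i q) * T q (V q) = T q (\<rho> (i q) *\<^sub>R V q)"
      by (rule scale[symmetric, OF section_tangent[OF V]])
    also have "\<dots> = (\<Sum>b\<in>Basis. T q (V q (y b) *\<^sub>R W b (i q)))"
      unfolding fr(5)[OF section_tangent[OF V]]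
      by (rule additive_on_subspace_sum[OF subspace_tangent_space[OF B] add tangent_space_scale[OF B t]])
    finally show ?thesis by (simp add: scale[OF t])
  qed
  moreover have "(\<lambda>q. \<Sum>b\<in>Basis. V q (y b) * T q (W b (i q))) \<in> smooth_functions A"
    by (intro smooth_functions_sum smooth_functions_mult A restr fr section_smooth[OF V])
  ultimately show "\<exists>\<rho>\<in>smooth_functions A. \<rho> p \<noteq> 0 \<and> (\<lambda>q. \<rho> q * T q (V q)) \<in> smooth_functions A"
    using comp_smooth[OF fr(1)] fr(2) by (intro bexI[of _ "\<lambda>q. \<rho> (i q)"]) auto
qed

text \<open>A pointwise lift through the differential carries no smoothness by itself. Its frame
  components solve a linear system with smooth coefficients, one equation for each ambient smooth
  function h, obtained by applying the frame expansion to h after \<open>i\<close>.\<close>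

lemma vector_field_of_section:
  assumes inj: "\<And>p. inj_on di (tangent_space A p)" and V: "V \<in> \<Gamma>"
    and s: "\<And>q. s q \<in> tangent_space A q" "\<And>q. di (s q) = V q"
  shows "s \<in> vector_fields A"
proof -
  have "(\<lambda>q. s q f) \<in> smooth_functions A" if f: "f \<in> smooth_functions A" for f
  proof (rule smooth_functions_local_division[OF A])
    fix p
    obtain \<rho> x and E :: "'f \<Rightarrow> 'b \<Rightarrow> 'b tvec" where fr: "\<rho> \<in> smooth_functions A" "\<rho> p = 1"
      "\<And>b. x b \<in> smooth_functions A" "\<And>b. E b \<in> vector_fields A"
      "\<And>q v. v \<in> tangent_space A q \<Longrightarrow> \<rho> q *\<^sub>R v = (\<Sum>b\<in>Basis. v (x b) *\<^sub>R E b q)"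
      "\<And>a b. a \<in> Basis \<Longrightarrow> b \<in> Basis \<Longrightarrow> E a p (x b) = (if a = b then 1 else 0)"
      by (rule local_frame[OF A, of p]) (rule that)
    have app: "\<rho> q * s q h = (\<Sum>b\<in>Basis. s q (x b) * E b q h)" for q h
      using fun_cong[OF fr(5)[OF s(1)[of q]], of h] by (simp add: sum_fun_apply scaleR_fun_apply)
    have "\<exists>\<sigma>\<in>smooth_functions A. \<sigma> p \<noteq> 0 \<and> (\<forall>b\<in>Basis. (\<lambda>q. \<sigma> q * s q (x b)) \<in> smooth_functions A)"
    proof (rule smooth_linear_system[where J = "\<lambda>h b q. E b q (\<lambda>r. h (i r))" and N = "smooth_functions B",
          OF A finite_Basis])
      show "(\<lambda>q. E b q (\<lambda>r. h (i r))) \<in> smooth_functions A" if "h \<in> smooth_functions B" for h b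
        by (rule vector_field_smooth[OF fr(4) comp_smooth[OF that]])
      show "(\<lambda>q. \<Sum>b\<in>Basis. E b q (\<lambda>r. h (i r)) * s q (x b)) \<in> smooth_functions A"
        if h: "h \<in> smooth_functions B" for h
      proof -
        have "s q (\<lambda>r. h (i r)) = V q h" for q
          using s(2)[of q] differential_apply[OF h, of i "s q"] by simp
        then have "(\<Sum>b\<in>Basis. E b q (\<lambda>r. h (i r)) * s q (x b)) = \<rho> q * V q h" for q
          using app[of q "\<lambda>r. h (i r)"] by (simp add: mult.commute)
        then show ?thesis
          using smooth_functions_mult[OF A fr(1) section_smooth[OF V h]] by simp
      qed
      fix l :: "'f \<Rightarrow> real"
      assume l: "\<And>h. h \<in> smooth_functions B \<Longrightarrow> (\<Sum>b\<in>Basis. l b * E b p (\<lambda>r. h (i r))) = 0"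
      \<comment> \<open>A relation between the columns says that the differential kills this
        combination of frame vectors. Injectivity makes it 0, and duality of the frame with the
        functions \<open>x b\<close> at p yields the coefficients.\<close>
      let ?e = "\<Sum>b\<in>Basis. l b *\<^sub>R E b p"
      have "di ?e = (\<lambda>h. 0)"
        using l by (auto simp: differential_def comp_def sum_fun_apply scaleR_fun_apply)
      then have "di ?e = di 0" unfolding differential_0 by (simp add: zero_fun_def)
      moreover have "?e \<in> tangent_space A p"
        by (intro tangent_space_sum[OF A] tangent_space_scale[OF A] vector_field_tangent fr(4))
      ultimately have "?e = 0"
        by (intro inj_onD[OF inj[of p]] tangent_space_0[OF A])
      show "\<forall>b\<in>Basis. l b = 0"
      proof
        fix b :: 'f assume b: "b \<in> Basis"
        have "(\<Sum>a\<in>Basis. l a * E a p (x b)) = ?e (x b)" by (simp add: sum_fun_apply scaleR_fun_apply)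
        also have "\<dots> = 0" by (simp add: \<open>?e = 0\<close>)
        finally show "l b = 0"
          using b by (simp add: fr(6) if_distrib[of "\<lambda>x. _ * x"] cong: if_cong)
      qed
    qed
    then obtain \<sigma> where \<sigma>: "\<sigma> \<in> smooth_functions A" "\<sigma> p \<noteq> 0"
      "\<And>b. b \<in> Basis \<Longrightarrow> (\<lambda>q. \<sigma> q * s q (x b)) \<in> smooth_functions A" by blast
    have "(\<lambda>q. \<Sum>b\<in>Basis. (\<sigma> q * s q (x b)) * E b q f) \<in> smooth_functions A"
      by (intro smooth_functions_sum smooth_functions_mult A \<sigma>(3) vector_field_smooth[OF fr(4) f])
    then have "(\<lambda>q. (\<sigma> q * \<rho> q) * s q f) \<in> smooth_functions A"
      using app[of _ f] by (simp add: mult.assoc sum_distrib_left[symmetric])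
    then show "\<exists>\<rho>\<in>smooth_functions A. \<rho> p \<noteq> 0 \<and> (\<lambda>q. \<rho> q * s q f) \<in> smooth_functions A"
      using smooth_functions_mult[OF A \<sigma>(1) fr(1)] \<sigma>(2) fr(2)
      by (intro bexI[of _ "\<lambda>q. \<sigma> q * \<rho> q"]) auto
  qed
  then show ?thesis using s(1) by (simp add: vector_fields_def sections_along_def)
qed

text \<open>The second-order terms cancel against the bracket, so the right-hand side sees X and Y
  only through their pushed-forward values at p. The torsion of fields on M can therefore be
  compared with that of any ambient fields having the same values there.\<close>

lemma torsion_in_frame:
  assumes X: "X \<in> vector_fields A" and Y: "Y \<in> vector_fields A"
    and fr: "\<rho> \<in> smooth_functions B" "\<rho> (i p) = 1"
    "\<And>b. y b \<in> smooth_functions B" "\<And>b. W b \<in> vector_fields B"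
    "\<And>q v. v \<in> tangent_space B q \<Longrightarrow> \<rho> q *\<^sub>R v = (\<Sum>b\<in>Basis. v (y b) *\<^sub>R W b q)"
  shows "D p (X p) (\<lambda>q. di (Y q)) - D p (Y p) (\<lambda>q. di (X q)) - di (lie_bracket X Y p) =
    (\<Sum>b\<in>Basis. di (Y p) (y b) *\<^sub>R nabbar (i p) (di (X p)) (W b)) - di (X p) \<rho> *\<^sub>R di (Y p)
    - ((\<Sum>b\<in>Basis. di (X p) (y b) *\<^sub>R nabbar (i p) (di (Y p)) (W b)) - di (Y p) \<rho> *\<^sub>R di (X p))"
proof -
  \<comment> \<open>The product rule applied to the frame expansion of the pushed-forward field; the
    subtracted term is the derivative of the cutoff.\<close>
  have half: "D p (X p) (\<lambda>q. di (Y q)) = (\<Sum>b\<in>Basis. X p (\<lambda>q. Y q (\<lambda>r. y b (i r))) *\<^sub>R W b (i p))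
      + (\<Sum>b\<in>Basis. di (Y p) (y b) *\<^sub>R nabbar (i p) (di (X p)) (W b)) - di (X p) \<rho> *\<^sub>R di (Y p)"
    if X: "X \<in> vector_fields A" and Y: "Y \<in> vector_fields A" for X Y
  proof -
    note Xp = vector_field_tangent[OF X, of p] and diY = pushforward_section[OF Y]
    have yY: "(\<lambda>q. Y q (\<lambda>r. y b (i r))) \<in> smooth_functions A" for b
      by (rule vector_field_smooth[OF Y comp_smooth[OF fr(3)]])
    have "(\<lambda>q. \<rho> (i q) *\<^sub>R di (Y q)) = (\<Sum>b\<in>Basis. (\<lambda>q. Y q (\<lambda>r. y b (i r)) *\<^sub>R W b (i q)))"
      using fr(5)[OF section_tangent[OF diY]] by (auto simp: sum_fun_apply differential_apply[OF fr(3)])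
    then have "D p (X p) (\<lambda>q. \<rho> (i q) *\<^sub>R di (Y q)) =
        (\<Sum>b\<in>Basis. D p (X p) (\<lambda>q. Y q (\<lambda>r. y b (i r)) *\<^sub>R W b (i q)))"
      using D_sum[OF Xp, of Basis "\<lambda>b q. Y q (\<lambda>r. y b (i r)) *\<^sub>R W b (i q)"]
        sections_scale[OF A B yY restriction_section[OF fr(4)]] by simp
    moreover have "D p (X p) (\<lambda>q. \<rho> (i q) *\<^sub>R di (Y q)) = di (X p) \<rho> *\<^sub>R di (Y p) + D p (X p) (\<lambda>q. di (Y q))"
      by (simp add: D_scale[OF Xp comp_smooth[OF fr(1)] diY] differential_apply[OF fr(1)] fr(2))
    moreover have "D p (X p) (\<lambda>q. Y q (\<lambda>r. y b (i r)) *\<^sub>R W b (i q)) =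
        X p (\<lambda>q. Y q (\<lambda>r. y b (i r))) *\<^sub>R W b (i p) + di (Y p) (y b) *\<^sub>R nabbar (i p) (di (X p)) (W b)" for b
      by (simp add: D_scale[OF Xp yY restriction_section[OF fr(4)]] D_restriction[OF fr(4) Xp]
          differential_apply[OF fr(3)])
    ultimately show ?thesis by (simp add: sum.distrib algebra_simps)
  qed
  have "di (lie_bracket X Y p) = \<rho> (i p) *\<^sub>R di (lie_bracket X Y p)" by (simp add: fr(2))
  also have "\<dots> = (\<Sum>b\<in>Basis. di (lie_bracket X Y p) (y b) *\<^sub>R W b (i p))"
    by (intro fr(5) di_tangent vector_field_tangent lie_bracket_vector_field A X Y)
  also have "\<dots> = (\<Sum>b\<in>Basis. X p (\<lambda>q. Y q (\<lambda>r. y b (i r))) *\<^sub>R W b (i p))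
      - (\<Sum>b\<in>Basis. Y p (\<lambda>q. X q (\<lambda>r. y b (i r))) *\<^sub>R W b (i p))"
    by (simp add: differential_apply[OF fr(3)] lie_bracket_def scaleR_diff_left sum_subtractf)
  finally show ?thesis unfolding half[OF X Y] half[OF Y X] by simp
qed

end

section \<open>Submanifolds of Riemannian manifolds\<close>

lemma smooth_map_id: "smooth_atlas A \<Longrightarrow> smooth_map A A (\<lambda>p. p)"
  by (auto simp: smooth_map_def smooth_atlas_def comp_def)

lemma differential_id:
  fixes A :: "('a::{t2_space,second_countable_topology}, 'e::euclidean_space) atlas"
  shows "u \<in> tangent_space A p \<Longrightarrow> differential A (\<lambda>p. p) u = u"
  using tangent_nonsmooth[of u A p] by (auto simp: differential_def comp_def fun_eq_iff)

text \<open>Ordinary connections become connections along the identity, so the same results serve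
  the ambient connection and the intrinsic connection of M.\<close>

lemma pulled_back_connection_id:
  assumes "smooth_atlas A" "connection_along A A (\<lambda>p. p) nab"
  shows "pulled_back_connection A A (\<lambda>p. p) nab nab"
  using assms smooth_map_id
  by unfold_locales (auto simp: pullback_connection_def comp_def differential_id)

text \<open>X' and Y' match the pushed-forward fields at the single point i p. That suffices: the
  frame formula for \<open>i\<close> and the one for the identity, taken in the same frame, have
  equal right-hand sides, and the ambient torsion vanishes.\<close>

lemma (in pulled_back_connection) torsion_free:
  assumes LC: "levi_civita B g nabbar" and X: "X \<in> vector_fields A" and Y: "Y \<in> vector_fields A"
  shows "D p (X p) (\<lambda>q. di (Y q)) - D p (Y p) (\<lambda>q. di (X q)) = di (lie_bracket X Y p)"
proof -
  have con: "connection_along B B (\<lambda>p. p) nabbar" using LC by (simp add: levi_civita_def)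
  interpret id: pulled_back_connection B B "\<lambda>p. p" nabbar nabbar
    by (rule pulled_back_connection_id[OF B con])
  obtain \<rho> y and W :: "'e \<Rightarrow> 'a \<Rightarrow> 'a tvec" where fr: "\<rho> \<in> smooth_functions B" "\<rho> (i p) = 1"
    "\<And>b. y b \<in> smooth_functions B" "\<And>b. W b \<in> vector_fields B"
    "\<And>q v. v \<in> tangent_space B q \<Longrightarrow> \<rho> q *\<^sub>R v = (\<Sum>b\<in>Basis. v (y b) *\<^sub>R W b q)"
    "\<And>a b. a \<in> Basis \<Longrightarrow> b \<in> Basis \<Longrightarrow> W a (i p) (y b) = (if a = b then 1 else 0)"
    by (rule local_frame[OF B, of "i p"]) (rule that)
  obtain X' where X': "X' \<in> vector_fields B" "X' (i p) = di (X p)"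
    by (rule vector_field_extension[OF B di_tangent[OF vector_field_tangent[OF X]]])
  obtain Y' where Y': "Y' \<in> vector_fields B" "Y' (i p) = di (Y p)"
    by (rule vector_field_extension[OF B di_tangent[OF vector_field_tangent[OF Y]]])
  have "cov nabbar X' Y' - cov nabbar Y' X' = lie_bracket X' Y'"
    using LC X'(1) Y'(1) by (simp add: levi_civita_def)
  then have "nabbar (i p) (X' (i p)) Y' - nabbar (i p) (Y' (i p)) X' - lie_bracket X' Y' (i p) = 0"
    by (simp add: cov_def fun_eq_iff)
  moreover have idd: "id.di (V q) = V q" if "V \<in> vector_fields B" for V q
    by (rule differential_id[OF vector_field_tangent[OF that]])
  ultimately show ?thesis
    using torsion_in_frame[OF X Y fr(1-5)] id.torsion_in_frame[OF X'(1) Y'(1) fr(1-5)]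
    by (simp add: idd X' Y' lie_bracket_vector_field[OF B]
        differential_id[OF di_tangent[OF vector_field_tangent[OF X]]]
        differential_id[OF di_tangent[OF vector_field_tangent[OF Y]]])
qed

section \<open>Metric compatibility along a map\<close>

locale riemannian_pullback = pulled_back_connection A B i nabbar D
  for A :: "('b::{t2_space,second_countable_topology}, 'f::euclidean_space) atlas"
    and B :: "('a::{t2_space,second_countable_topology}, 'e::euclidean_space) atlas"
    and i :: "'b \<Rightarrow> 'a"
    and nabbar :: "('a, 'a tvec) connection"
    and D :: "('b, 'a tvec) connection" +
  fixes g :: "'a metric"
  assumes g: "riemannian_metric B g" and LC: "levi_civita B g nabbar"
begin

context
  fixes p u v assumes u: "u \<in> tangent_space B p" and v: "v \<in> tangent_space B p"
begin

lemma g_sym: "g p u v = g p v u"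
  using g u v unfolding riemannian_metric_def by blast

lemma g_add: "w \<in> tangent_space B p \<Longrightarrow> g p (u + v) w = g p u w + g p v w"
  using g u v unfolding riemannian_metric_def by blast

lemma g_scale: "g p (k *\<^sub>R u) v = k * g p u v"
  using g u v unfolding riemannian_metric_def by blast

end

lemma g_definite: "u \<in> tangent_space B p \<Longrightarrow> g p u u = 0 \<Longrightarrow> u = 0"
  using g unfolding riemannian_metric_def by (metis less_irrefl)

lemma g_diff:
  assumes "u \<in> tangent_space B p" "v \<in> tangent_space B p" "w \<in> tangent_space B p"
  shows "g p (u - v) w = g p u w - g p v w"
proof -
  have "g p ((u - v) + v) w = g p (u - v) w + g p v w"
    by (intro g_add tangent_space_diff[OF B] assms)
  then show ?thesis by (simp only: diff_add_cancel)
qed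

lemma g_add_right:
  assumes "u \<in> tangent_space B p" "v \<in> tangent_space B p" "w \<in> tangent_space B p"
  shows "g p w (u + v) = g p w u + g p w v"
  by (simp only: g_sym[OF assms(3)] assms tangent_space_add[OF B] g_add)

lemma g_scale_right:
  assumes "u \<in> tangent_space B p" "v \<in> tangent_space B p"
  shows "g p v (k *\<^sub>R u) = k * g p v u"
  by (simp only: g_sym[OF assms(2)] assms tangent_space_scale[OF B] g_scale)

lemma metric_smooth:
  assumes V: "V \<in> \<Gamma>" and W: "W \<in> \<Gamma>"
  shows "(\<lambda>q. g (i q) (V q) (W q)) \<in> smooth_functions A"
proof (rule smooth_pairing[OF _ _ _ V])
  fix V' assume V': "V' \<in> vector_fields B"
  note t = vector_field_tangent[OF V']
  show "(\<lambda>q. g (i q) (V' (i q)) (W q)) \<in> smooth_functions A"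
  proof (rule smooth_pairing[OF _ _ _ W])
    show "(\<lambda>q. g (i q) (V' (i q)) (W' (i q))) \<in> smooth_functions A" if "W' \<in> vector_fields B" for W'
      using g V' that unfolding riemannian_metric_def
      by (intro comp_smooth[where f = "\<lambda>q. g q (V' q) (W' q)"]) blast
  qed (simp_all only: g_add_right g_scale_right t)
qed (simp_all only: g_add g_scale section_tangent[OF W])

text \<open>The defect \<open>?T\<close> of the product rule is function-linear in each slot, since
  the terms with the derivative of a coefficient cancel, and it vanishes on restrictions of ambient
  fields. \<open>tensorial_vanishing\<close> treats one slot at a time, and \<open>sym\<close>
  exchanges them.\<close>

lemma metric_compatible:
  assumes u: "u \<in> tangent_space A p" and V: "V \<in> \<Gamma>" and W: "W \<in> \<Gamma>"
  shows "u (\<lambda>q. g (i q) (V q) (W q)) = g (i p) (D p u V) (W p) + g (i p) (V p) (D p u W)"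
proof -
  let ?T = "\<lambda>V W. u (\<lambda>q. g (i q) (V q) (W q)) - (g (i p) (D p u V) (W p) + g (i p) (V p) (D p u W))"
  have sym: "?T V W = ?T W V" if "V \<in> \<Gamma>" "W \<in> \<Gamma>" for V W
    using that by (simp add: g_sym[of "V _" _ "W _"] g_sym[of "D p u _"] section_tangent D_tangent[OF u])
  have add: "?T (V + V') W = ?T V W + ?T V' W" if "V \<in> \<Gamma>" "V' \<in> \<Gamma>" "W \<in> \<Gamma>" for V V' W
  proof -
    have "u (\<lambda>q. g (i q) ((V + V') q) (W q)) = u (\<lambda>q. g (i q) (V q) (W q)) + u (\<lambda>q. g (i q) (V' q) (W q))"
      unfolding plus_fun_apply[of V V']
      by (simp only: g_add[OF that(1,2,3)[THEN section_tangent]] tangent_add[OF u] metric_smooth that)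
    then show ?thesis
      unfolding plus_fun_apply[of V V'] D_add[OF u that(1,2)]
      by (simp only: g_add section_tangent[OF that(1)] section_tangent[OF that(2)]
          section_tangent[OF that(3)] D_tangent[OF u that(1)] D_tangent[OF u that(2)] D_tangent[OF u that(3)])
  qed
  have scale: "?T (\<lambda>q. f q *\<^sub>R V q) W = f p *\<^sub>R ?T V W"
    if "f \<in> smooth_functions A" "V \<in> \<Gamma>" "W \<in> \<Gamma>" for f V W
  proof -
    note t = section_tangent[OF that(2)] section_tangent[OF that(3)]
      D_tangent[OF u that(2)] D_tangent[OF u that(3)]
    have "u (\<lambda>q. g (i q) (f q *\<^sub>R V q) (W q)) = f p * u (\<lambda>q. g (i q) (V q) (W q)) + g (i p) (V p) (W p) * u f"
      by (simp only: g_scale[OF t(1,2)] tangent_mult[OF u that(1) metric_smooth[OF that(2,3)]])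
    then show ?thesis
      unfolding D_scale[OF u that(1,2)]
      by (simp only: g_add g_scale t tangent_space_scale[OF B] real_scaleR_def) (simp add: algebra_simps)
  qed
  have base: "?T (\<lambda>q. V' (i q)) (\<lambda>q. W' (i q)) = 0"
    if V': "V' \<in> vector_fields B" and W': "W' \<in> vector_fields B" for V' W'
  proof -
    obtain X where X: "X \<in> vector_fields B" "X (i p) = di u"
      by (rule vector_field_extension[OF B di_tangent[OF u]])
    have "(\<lambda>q. g q (V' q) (W' q)) \<in> smooth_functions B"
      using g V' W' unfolding riemannian_metric_def by blast
    then have "u (\<lambda>q. g (i q) (V' (i q)) (W' (i q))) = X (i p) (\<lambda>q. g q (V' q) (W' q))"
      unfolding X(2) by (rule differential_apply[symmetric])
    also have "\<dots> = g (i p) (cov nabbar X V' (i p)) (W' (i p)) + g (i p) (V' (i p)) (cov nabbar X W' (i p))"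
      using LC X(1) V' W' unfolding levi_civita_def by blast
    finally show ?thesis
      by (simp add: D_restriction[OF _ u] V' W' cov_def X(2))
  qed
  have "?T V W = 0"
  proof (rule tensorial_vanishing[OF u, where T = "\<lambda>V. ?T V W", OF add[OF _ _ W] scale[OF _ _ W] _ V])
    fix V' assume V': "V' \<in> vector_fields B"
    note V'' = restriction_section[OF V']
    have "?T W (\<lambda>q. V' (i q)) = 0"
    proof (rule tensorial_vanishing[OF u, where T = "\<lambda>W. ?T W (\<lambda>q. V' (i q))",
          OF add[OF _ _ V''] scale[OF _ _ V''] base[OF _ V'] W])
    qed
    then show "?T (\<lambda>q. V' (i q)) W = 0" using sym[OF V'' W] by simp
  qed
  then show ?thesis by simp
qed

end

section \<open>The second fundamental form and the normal connection\<close>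

locale riemannian_immersion = riemannian_pullback A B i nabbar D g
  for A :: "('b::{t2_space,second_countable_topology}, 'f::euclidean_space) atlas"
    and B :: "('a::{t2_space,second_countable_topology}, 'e::euclidean_space) atlas"
    and i :: "'b \<Rightarrow> 'a"
    and nabbar :: "('a, 'a tvec) connection"
    and D :: "('b, 'a tvec) connection"
    and g :: "'a metric" +
  fixes nab :: "('b, 'b tvec) connection"
  assumes inj: "inj_on di (tangent_space A p)"
    and LCM: "levi_civita A (induced_metric B i g) nab"
begin

sublocale nab: pulled_back_connection A A "\<lambda>p. p" nab nab
  using LCM by (intro pulled_back_connection_id A) (simp add: levi_civita_def)

abbreviation "h \<equiv> second_fundamental_form B i D nab"
abbreviation "\<X> \<equiv> vector_fields A"
abbreviation "N \<equiv> normal_connection A B i g D"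

lemma h_apply: "h X Y p = D p (X p) (\<lambda>q. di (Y q)) - di (nab p (X p) Y)"
  by (simp add: second_fundamental_form_def cov_def comp_def)

lemma nab_tangent: "u \<in> tangent_space A p \<Longrightarrow> Y \<in> \<X> \<Longrightarrow> nab p u Y \<in> tangent_space A p"
  using nab.D_tangent by (simp add: vector_fields_def)

lemma cov_field: "X \<in> \<X> \<Longrightarrow> Y \<in> \<X> \<Longrightarrow> cov nab X Y \<in> \<X>"
  using nab.connection by (simp add: connection_along_def vector_fields_def)

lemma nab_torsion_free:
  "X \<in> \<X> \<Longrightarrow> Y \<in> \<X> \<Longrightarrow> nab p (X p) Y - nab p (Y p) X = lie_bracket X Y p"
  using LCM by (auto simp: levi_civita_def cov_def fun_eq_iff)

lemma curvature_field:
  assumes "X \<in> \<X>" "Y \<in> \<X>" "Z \<in> \<X>"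
  shows "curvature nab X Y Z \<in> \<X>"
proof -
  have "curvature nab X Y Z \<in> sections_along A A (\<lambda>p. p)"
    unfolding curvature_def
    by (intro sections_diff[OF A A] cov_field[unfolded vector_fields_def]
        assms[unfolded vector_fields_def] lie_bracket_vector_field[OF A assms(1,2), unfolded vector_fields_def])
  then show ?thesis by (simp add: vector_fields_def)
qed

lemma h_tangent: "X \<in> \<X> \<Longrightarrow> Y \<in> \<X> \<Longrightarrow> h X Y p \<in> tangent_space B (i p)"
  unfolding h_apply
  by (intro tangent_space_diff[OF B] D_tangent di_tangent nab_tangent pushforward_section vector_field_tangent)

lemma h_sym:
  assumes "X \<in> \<X>" "Y \<in> \<X>"
  shows "h X Y p = h Y X p"
proof -
  have "di (nab p (X p) Y) - di (nab p (Y p) X) = di (lie_bracket X Y p)"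
    using nab_torsion_free[OF assms] by (simp only: differential_diff[symmetric])
  then show ?thesis
    unfolding h_apply using torsion_free[OF LC assms, of p] by (simp add: algebra_simps)
qed

text \<open>The first argument enters both connections only through its value at p, so a relation at
  this single point is enough. Symmetry of \<open>h\<close> carries this over to the second
  argument, where the definition does not show it.\<close>

lemma h_combination_left:
  assumes "X \<in> \<X>" "Y \<in> \<X>" "Z \<in> \<X>" "U \<in> \<X>" and U: "U p = a *\<^sub>R X p + b *\<^sub>R Y p"
  shows "h U Z p = a *\<^sub>R h X Z p + b *\<^sub>R h Y Z p"
proof -
  note t = vector_field_tangent[OF assms(1), of p] vector_field_tangent[OF assms(2), of p]
  have comb: "D' p (a *\<^sub>R X p + b *\<^sub>R Y p) V = a *\<^sub>R D' p (X p) V + b *\<^sub>R D' p (Y p) V"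
    if "connection_along A B' i' D'" "V \<in> sections_along A B' i'"
    for B' :: "('c::{t2_space,second_countable_topology}, 'd::euclidean_space) atlas" and i' D' V
  proof -
    have "D' p (a *\<^sub>R X p + b *\<^sub>R Y p) V = D' p (a *\<^sub>R X p) V + D' p (b *\<^sub>R Y p) V"
      using that tangent_space_scale[OF A t(1)] tangent_space_scale[OF A t(2)]
      unfolding connection_along_def by blast
    moreover have "D' p (a *\<^sub>R X p) V = a *\<^sub>R D' p (X p) V" "D' p (b *\<^sub>R Y p) V = b *\<^sub>R D' p (Y p) V"
      using that t unfolding connection_along_def by blast+
    ultimately show ?thesis by simp
  qed
  show ?thesis
    unfolding h_apply U comb[OF connection pushforward_section[OF assms(3)]]
      comb[OF nab.connection assms(3)[unfolded vector_fields_def]] differential_add differential_scale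
    by (simp only: scaleR_diff_right) simp
qed

lemma h_combination_right:
  assumes "X \<in> \<X>" "Y \<in> \<X>" "Z \<in> \<X>" "U \<in> \<X>" and U: "U p = a *\<^sub>R X p + b *\<^sub>R Y p"
  shows "h Z U p = a *\<^sub>R h Z X p + b *\<^sub>R h Z Y p"
  using h_combination_left[OF assms] by (simp only: h_sym assms)

text \<open>The form \<open>g(h(X, Y), Z)\<close> is symmetric in \<open>X, Y\<close> and skew in \<open>Y, Z\<close>, hence zero.\<close>

lemma h_normal:
  assumes X: "X \<in> \<X>" and Y: "Y \<in> \<X>" and Z: "Z \<in> \<X>"
  shows "g (i p) (h X Y p) (di (Z p)) = 0"
proof -
  let ?b = "\<lambda>X Y Z. g (i p) (h X Y p) (di (Z p))"
  have sym: "?b X Y Z = ?b Y X Z" if "X \<in> \<X>" "Y \<in> \<X>" for X Y Z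
    using h_sym[OF that] by simp
  have skew: "?b X Y Z = - ?b X Z Y" if "X \<in> \<X>" "Y \<in> \<X>" "Z \<in> \<X>" for X Y Z
  proof -
    note t = vector_field_tangent[OF that(1), of p]
      and Y = pushforward_section[OF that(2)] and Z = pushforward_section[OF that(3)]
    note tYZ = section_tangent[OF Y, of p] section_tangent[OF Z, of p]
      D_tangent[OF t Y] D_tangent[OF t Z]
      di_tangent[OF nab_tangent[OF t that(2)]] di_tangent[OF nab_tangent[OF t that(3)]]
    have "X p (\<lambda>q. g (i q) (di (Y q)) (di (Z q))) =
        g (i p) (di (nab p (X p) Y)) (di (Z p)) + g (i p) (di (Y p)) (di (nab p (X p) Z))"
      using LCM that by (simp add: levi_civita_def induced_metric_def cov_def)
    then have "g (i p) (di (nab p (X p) Y)) (di (Z p)) + g (i p) (di (Y p)) (di (nab p (X p) Z)) =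
        g (i p) (D p (X p) (\<lambda>q. di (Y q))) (di (Z p)) + g (i p) (di (Y p)) (D p (X p) (\<lambda>q. di (Z q)))"
      using metric_compatible[OF t Y Z] by simp
    then show ?thesis
      by (simp add: h_apply g_diff g_sym[of "di (Y p)"] tYZ)
  qed
  \<comment> \<open>Alternating the two symmetries passes through all six orders of X, Y, Z and
    returns after three sign changes.\<close>
  have "?b X Y Z = - ?b X Y Z"
    using skew[OF X Y Z] sym[OF X Z] skew[OF Z X Y] sym[OF Z Y] skew[OF Y Z X] sym[OF Y X] by simp
  then show ?thesis by simp
qed

text \<open>A vector both normal and tangent is orthogonal to itself. The vector z is extended to a
  field because normality of \<open>h\<close> is stated for fields.\<close>

lemma h_eq_0_if_tangential:
  assumes "X \<in> \<X>" "Y \<in> \<X>" and z: "z \<in> tangent_space A p" "h X Y p = di z"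
  shows "h X Y p = 0"
proof -
  obtain Z where "Z \<in> \<X>" "Z p = z" by (rule vector_field_extension[OF A z(1)])
  then have "g (i p) (h X Y p) (h X Y p) = 0" using h_normal[OF assms(1,2)] z(2) by metis
  then show ?thesis by (rule g_definite[OF h_tangent[OF assms(1,2)]])
qed

text \<open>The normal connection and its curvature are later applied to zero sections, so this is
  the value of the definite description on which the argument rests. Uniqueness holds because a
  normal vector that is also tangent has length 0.\<close>

lemma normal_part_0: "normal_part A B i g p 0 = 0"
  unfolding normal_part_def
proof (rule the_equality)
  have "g (i p) (0 *\<^sub>R 0) (di u) = 0 * g (i p) 0 (di u)" if "u \<in> tangent_space A p" for u
    by (rule g_scale[OF tangent_space_0[OF B] di_tangent[OF that]])
  then show "0 \<in> normal_space A B i g p \<and> 0 - 0 \<in> di ` tangent_space A p"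
    using tangent_space_0[OF B] tangent_space_0[OF A, of p] differential_0[of B i]
    by (auto simp: normal_space_def image_iff intro!: bexI[of _ 0])
next
  fix n assume n: "n \<in> normal_space A B i g p \<and> 0 - n \<in> di ` tangent_space A p"
  then obtain z where z: "z \<in> tangent_space A p" "0 - n = di z" by blast
  have nB: "n \<in> tangent_space B (i p)" using n by (simp add: normal_space_def)
  have "n = (- 1) *\<^sub>R di z" using z(2) by (metis diff_0 minus_minus scaleR_minus1_left)
  moreover have "g (i p) n (di z) = 0" using n z(1) by (simp add: normal_space_def)
  ultimately have "g (i p) n n = 0"
    using g_scale_right[OF di_tangent[OF z(1)] nB, of "- 1"] by simp
  then show "n = 0" by (rule g_definite[OF nB])
qed

lemma cov_normal_0: "X \<in> \<X> \<Longrightarrow> cov N X 0 = 0"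
  by (rule ext) (simp only: cov_def normal_connection_def D_zero vector_field_tangent normal_part_0 zero_fun_apply)

lemma curvature_normal_0: "X \<in> \<X> \<Longrightarrow> Y \<in> \<X> \<Longrightarrow> curvature N X Y 0 = 0"
  unfolding curvature_def by (simp only: cov_normal_0 lie_bracket_vector_field[OF A]) simp

lemma totally_geodesic_imp_two_semiparallel:
  assumes tg: "totally_geodesic A B i D nab"
  shows "two_semiparallel A B i g D nab"
proof -
  have h0: "h X Y = 0" if "X \<in> \<X>" "Y \<in> \<X>" for X Y
    using tg that by (simp add: totally_geodesic_def)
  have nabh0: "cov_second_fundamental_form A B i g D nab Z U W = 0" if "Z \<in> \<X>" "U \<in> \<X>" "W \<in> \<X>" for Z U W
    unfolding cov_second_fundamental_form_def Let_def
    by (simp only: h0 cov_field that cov_normal_0) simp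
  then show ?thesis
    unfolding two_semiparallel_def Let_def
    by (intro ballI) (simp only: nabh0 curvature_field curvature_normal_0 diff_0_right)
qed

end

section \<open>Invariant submanifolds\<close>

locale invariant_submanifold_setting = riemannian_immersion A B i nabbar D g nab
  for A :: "('b::{t2_space,second_countable_topology}, 'f::euclidean_space) atlas"
    and B :: "('a::{t2_space,second_countable_topology}, 'e::euclidean_space) atlas"
    and i :: "'b \<Rightarrow> 'a"
    and nabbar :: "('a, 'a tvec) connection"
    and D :: "('b, 'a tvec) connection"
    and g :: "'a metric"
    and nab :: "('b, 'b tvec) connection" +
  fixes \<phi> :: "'a \<Rightarrow> 'a tvec \<Rightarrow> 'a tvec" and \<xi> :: "'a \<Rightarrow> 'a tvec" and \<eta> :: "'a \<Rightarrow> 'a tvec \<Rightarrow> real"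
    and f1 f3 :: "'a \<Rightarrow> real"
  assumes acm: "almost_contact_metric B g \<phi> \<xi> \<eta>"
    and f1: "f1 \<in> smooth_functions B" and f3: "f3 \<in> smooth_functions B"
    and struct: "structure_equations B g \<phi> \<xi> \<eta> f1 f3 nabbar"
    and f1_neq_f3: "f1 x \<noteq> f3 x"
    and \<xi>_tangent: "\<xi> (i p) \<in> di ` tangent_space A p"
    and \<phi>_invariant: "u \<in> tangent_space A p \<Longrightarrow> \<phi> (i p) (di u) \<in> di ` tangent_space A p"
begin

definition c :: "'b \<Rightarrow> real" where "c p = f1 (i p) - f3 (i p)"

lemma c_smooth: "c \<in> smooth_functions A"
  using smooth_functions_diff[OF A comp_smooth[OF f1] comp_smooth[OF f3]] by (simp add: c_def[abs_def])

lemma c_nonzero: "c p \<noteq> 0"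
  using f1_neq_f3 by (simp add: c_def)

lemma \<xi>_field: "\<xi> \<in> vector_fields B"
  using acm unfolding almost_contact_metric_def by blast

lemma \<phi>_field: "X \<in> vector_fields B \<Longrightarrow> (\<lambda>p. \<phi> p (X p)) \<in> vector_fields B"
  using acm unfolding almost_contact_metric_def by blast

lemma \<phi>_\<xi>: "\<phi> p (\<xi> p) = 0"
  using acm unfolding almost_contact_metric_def by blast

context
  fixes p u assumes u: "u \<in> tangent_space B p"
begin

lemma \<phi>_tangent: "\<phi> p u \<in> tangent_space B p"
  using acm u unfolding almost_contact_metric_def by blast

lemma \<phi>_add: "v \<in> tangent_space B p \<Longrightarrow> \<phi> p (u + v) = \<phi> p u + \<phi> p v"
  and \<eta>_add: "v \<in> tangent_space B p \<Longrightarrow> \<eta> p (u + v) = \<eta> p u + \<eta> p v"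
  using acm u unfolding almost_contact_metric_def by blast+

lemma \<phi>_scale: "\<phi> p (k *\<^sub>R u) = k *\<^sub>R \<phi> p u"
  and \<eta>_scale: "\<eta> p (k *\<^sub>R u) = k * \<eta> p u"
  using acm u unfolding almost_contact_metric_def by blast+

lemma \<phi>_\<phi>: "\<phi> p (\<phi> p u) = - u + \<eta> p u *\<^sub>R \<xi> p"
  and g_\<xi>: "g p u (\<xi> p) = \<eta> p u"
  and \<eta>_\<phi>: "\<eta> p (\<phi> p u) = 0"
  using acm u unfolding almost_contact_metric_def by blast+

end

text \<open>Evaluation at a fixed smooth f turns \<phi> into a real-valued fibrewise linear
  functional, so \<open>smooth_pairing\<close> applies.\<close>

lemma \<phi>_section:
  assumes V: "V \<in> \<Gamma>"
  shows "(\<lambda>q. \<phi> (i q) (V q)) \<in> \<Gamma>"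
proof -
  have "(\<lambda>q. \<phi> (i q) (V q) f) \<in> smooth_functions A" if f: "f \<in> smooth_functions B" for f
  proof (rule smooth_pairing[OF _ _ _ V])
    show "(\<lambda>q. \<phi> (i q) (W (i q)) f) \<in> smooth_functions A" if "W \<in> vector_fields B" for W
      by (rule comp_smooth[OF vector_field_smooth[OF \<phi>_field[OF that] f]])
    show "\<phi> (i q) (u + v) f = \<phi> (i q) u f + \<phi> (i q) v f"
      if "u \<in> tangent_space B (i q)" "v \<in> tangent_space B (i q)" for q u v
      unfolding \<phi>_add[OF that] by (rule plus_fun_apply)
    show "\<phi> (i q) (k *\<^sub>R v) f = k * \<phi> (i q) v f" if "v \<in> tangent_space B (i q)" for q k v
      unfolding \<phi>_scale[OF that] by (simp only: scaleR_fun_apply real_scaleR_def)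
  qed
  then show ?thesis using \<phi>_tangent[OF section_tangent[OF V]] by (simp add: sections_along_def)
qed

lemma D_\<xi>:
  assumes u: "u \<in> tangent_space A p"
  shows "D p u (\<lambda>q. \<xi> (i q)) = - c p *\<^sub>R \<phi> (i p) (di u)"
proof -
  obtain X where X: "X \<in> vector_fields B" "X (i p) = di u"
    by (rule vector_field_extension[OF B di_tangent[OF u]])
  have "cov nabbar X \<xi> (i p) = - (f1 (i p) - f3 (i p)) *\<^sub>R \<phi> (i p) (X (i p))"
    using struct X(1) unfolding structure_equations_def by blast
  then show ?thesis by (simp add: D_restriction[OF \<xi>_field u] cov_def X(2) c_def)
qed

text \<open>The structure equation speaks of ambient fields, while V lives along M. The difference
  \<open>?T\<close> of the two sides is function-linear in V, because the derivative of a
  coefficient contributes the same multiple of \<phi> V to both sides.\<close>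

lemma D_\<phi>:
  assumes u: "u \<in> tangent_space A p" and V: "V \<in> \<Gamma>"
  shows "D p u (\<lambda>q. \<phi> (i q) (V q)) = \<phi> (i p) (D p u V)
    + c p *\<^sub>R (g (i p) (di u) (V p) *\<^sub>R \<xi> (i p) - \<eta> (i p) (V p) *\<^sub>R di u)"
proof -
  let ?T = "\<lambda>V. D p u (\<lambda>q. \<phi> (i q) (V q)) - (\<phi> (i p) (D p u V)
    + c p *\<^sub>R (g (i p) (di u) (V p) *\<^sub>R \<xi> (i p) - \<eta> (i p) (V p) *\<^sub>R di u))"
  have "?T V = 0"
  proof (rule tensorial_vanishing[OF u _ _ _ V])
    fix V W assume V: "V \<in> \<Gamma>" and W: "W \<in> \<Gamma>"
    note t = section_tangent[OF V] section_tangent[OF W] D_tangent[OF u V] D_tangent[OF u W] di_tangent[OF u]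
    have "(\<lambda>q. \<phi> (i q) ((V + W) q)) = (\<lambda>q. \<phi> (i q) (V q)) + (\<lambda>q. \<phi> (i q) (W q))"
      unfolding plus_fun_apply[of V W] by (simp only: \<phi>_add[OF t(1,2)] plus_fun_def[of "\<lambda>q. \<phi> (i q) (V q)"])
    then have "D p u (\<lambda>q. \<phi> (i q) ((V + W) q)) = D p u (\<lambda>q. \<phi> (i q) (V q)) + D p u (\<lambda>q. \<phi> (i q) (W q))"
      by (simp only: D_add[OF u \<phi>_section[OF V] \<phi>_section[OF W]])
    then show "?T (V + W) = ?T V + ?T W"
      unfolding D_add[OF u V W] plus_fun_apply[of V W] \<phi>_add[OF t(3,4)] \<eta>_add[OF t(1,2)]
        g_add_right[OF t(1,2,5)]
      by (simp only: scaleR_add_left scaleR_add_right scaleR_diff_right) (simp only: algebra_simps)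
  next
    fix f V assume f: "f \<in> smooth_functions A" and V: "V \<in> \<Gamma>"
    note t = section_tangent[OF V] D_tangent[OF u V] di_tangent[OF u]
    have "D p u (\<lambda>q. \<phi> (i q) (f q *\<^sub>R V q)) = u f *\<^sub>R \<phi> (i p) (V p) + f p *\<^sub>R D p u (\<lambda>q. \<phi> (i q) (V q))"
      by (simp only: \<phi>_scale[OF t(1)] D_scale[OF u f \<phi>_section[OF V]])
    moreover have "\<phi> (i p) (D p u (\<lambda>q. f q *\<^sub>R V q)) = u f *\<^sub>R \<phi> (i p) (V p) + f p *\<^sub>R \<phi> (i p) (D p u V)"
      by (simp only: D_scale[OF u f V] \<phi>_add \<phi>_scale tangent_space_scale[OF B] t)
    ultimately show "?T (\<lambda>q. f q *\<^sub>R V q) = f p *\<^sub>R ?T V"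
      by (simp only: \<eta>_scale[OF t(1)] g_scale_right[OF t(1,3)])
        (simp only: algebra_simps scaleR_scaleR)
  next
    fix W assume W: "W \<in> vector_fields B"
    obtain X where X: "X \<in> vector_fields B" "X (i p) = di u"
      by (rule vector_field_extension[OF B di_tangent[OF u]])
    have "cov nabbar X (\<lambda>q. \<phi> q (W q)) (i p) - \<phi> (i p) (cov nabbar X W (i p)) = (f1 (i p) - f3 (i p)) *\<^sub>R
        (g (i p) (X (i p)) (W (i p)) *\<^sub>R \<xi> (i p) - \<eta> (i p) (W (i p)) *\<^sub>R X (i p))"
      using struct X(1) W unfolding structure_equations_def by blast
    then show "?T (\<lambda>q. W (i q)) = 0"
      unfolding D_restriction[OF W u] D_restriction[OF \<phi>_field[OF W] u] cov_def X(2) c_def[symmetric]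
      by (simp only: diff_diff_eq[symmetric]) simp
  qed
  then show ?thesis by (simp only: right_minus_eq)
qed

section \<open>The structure tensors on the submanifold\<close>

definition \<xi>M :: "'b \<Rightarrow> 'b tvec" where
  "\<xi>M p = inv_into (tangent_space A p) di (\<xi> (i p))"

definition \<Phi> :: "('b \<Rightarrow> 'b tvec) \<Rightarrow> 'b \<Rightarrow> 'b tvec" where
  "\<Phi> X p = inv_into (tangent_space A p) di (\<phi> (i p) (di (X p)))"

lemma di_\<xi>M: "di (\<xi>M p) = \<xi> (i p)"
  unfolding \<xi>M_def by (rule f_inv_into_f[OF \<xi>_tangent])

lemma di_\<Phi>: "X \<in> \<X> \<Longrightarrow> di (\<Phi> X p) = \<phi> (i p) (di (X p))"
  unfolding \<Phi>_def by (rule f_inv_into_f[OF \<phi>_invariant[OF vector_field_tangent]])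

lemma \<xi>M_field: "\<xi>M \<in> \<X>"
proof (rule vector_field_of_section[OF inj restriction_section[OF \<xi>_field] _ di_\<xi>M])
  show "\<xi>M q \<in> tangent_space A q" for q
    unfolding \<xi>M_def by (rule inv_into_into[OF \<xi>_tangent])
qed

lemma \<Phi>_field:
  assumes X: "X \<in> \<X>"
  shows "\<Phi> X \<in> \<X>"
proof (rule vector_field_of_section[OF inj \<phi>_section[OF pushforward_section[OF X]] _ di_\<Phi>[OF X]])
  show "\<Phi> X q \<in> tangent_space A q" for q
    unfolding \<Phi>_def by (rule inv_into_into[OF \<phi>_invariant[OF vector_field_tangent[OF X]]])
qed

lemmas \<Phi>_tangent = vector_field_tangent[OF \<Phi>_field]
  and \<xi>M_tangent = vector_field_tangent[OF \<xi>M_field]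

lemma di_eqD:
  assumes "u \<in> tangent_space A p" "v \<in> tangent_space A p" "di u = di v"
  shows "u = v"
  using inj_onD[OF inj assms(3,1,2)] .

lemma \<Phi>_\<Phi>:
  assumes X: "X \<in> \<X>"
  shows "\<Phi> (\<Phi> X) p = (- 1) *\<^sub>R X p + \<eta> (i p) (di (X p)) *\<^sub>R \<xi>M p"
proof (rule di_eqD[where p = p])
  show "di (\<Phi> (\<Phi> X) p) = di ((- 1) *\<^sub>R X p + \<eta> (i p) (di (X p)) *\<^sub>R \<xi>M p)"
    unfolding di_\<Phi>[OF \<Phi>_field[OF X]] di_\<Phi>[OF X] differential_add differential_scale di_\<xi>M
      \<phi>_\<phi>[OF di_tangent[OF vector_field_tangent[OF X]]]
    by simp
qed (intro \<Phi>_tangent \<Phi>_field X vector_field_tangent[OF X] \<xi>M_tangent tangent_space_add[OF A]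
    tangent_space_scale[OF A])+

lemma \<Phi>_\<Phi>_\<Phi>:
  assumes X: "X \<in> \<X>"
  shows "\<Phi> (\<Phi> (\<Phi> X)) p = (- 1) *\<^sub>R \<Phi> X p"
  using \<Phi>_\<Phi>[OF \<Phi>_field[OF X], of p]
  by (simp only: di_\<Phi>[OF X] \<eta>_\<phi>[OF di_tangent[OF vector_field_tangent[OF X]]]) simp

lemma h_\<xi>M:
  assumes X: "X \<in> \<X>"
  shows "h X \<xi>M = 0" and "h \<xi>M X = 0"
proof -
  have "h X \<xi>M p = 0" for p
  proof (rule h_eq_0_if_tangential[OF X \<xi>M_field])
    note t = vector_field_tangent[OF X, of p]
    show "h X \<xi>M p = di (- c p *\<^sub>R \<Phi> X p - nab p (X p) \<xi>M)"
      unfolding h_apply di_\<xi>M D_\<xi>[OF t] differential_diff differential_scale di_\<Phi>[OF X] ..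
    show "- c p *\<^sub>R \<Phi> X p - nab p (X p) \<xi>M \<in> tangent_space A p"
      by (intro tangent_space_diff[OF A] tangent_space_scale[OF A] nab_tangent t \<xi>M_field
          \<Phi>_tangent[OF X])
  qed
  then show "h X \<xi>M = 0" by (intro ext) (simp only: zero_fun_apply)
  with h_sym[OF X \<xi>M_field] show "h \<xi>M X = 0" by (intro ext) (metis zero_fun_apply)
qed

lemma nab_\<xi>M:
  assumes X: "X \<in> \<X>"
  shows "nab p (X p) \<xi>M = - c p *\<^sub>R \<Phi> X p"
proof (rule di_eqD[where p = p])
  note t = vector_field_tangent[OF X, of p]
  have "h X \<xi>M p = 0" by (simp only: h_\<xi>M(1)[OF X] zero_fun_apply)
  then show "di (nab p (X p) \<xi>M) = di (- c p *\<^sub>R \<Phi> X p)"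
    unfolding h_apply di_\<xi>M D_\<xi>[OF t] differential_scale di_\<Phi>[OF X] by simp
  show "nab p (X p) \<xi>M \<in> tangent_space A p" "- c p *\<^sub>R \<Phi> X p \<in> tangent_space A p"
    by (intro nab_tangent t \<xi>M_field tangent_space_scale[OF A] \<Phi>_tangent[OF X])+
qed

lemma \<Phi>_\<xi>M: "\<Phi> \<xi>M p = 0"
proof (rule di_eqD[where p = p])
  show "di (\<Phi> \<xi>M p) = di 0"
    unfolding di_\<Phi>[OF \<xi>M_field] di_\<xi>M differential_0 by (rule \<phi>_\<xi>)
qed (intro \<Phi>_tangent \<xi>M_field tangent_space_0[OF A])+

text \<open>In the direction \<xi> the Gauss formula has no normal part, and the correction in
  \<open>D_\<phi>\<close> becomes g(\<xi>, X) \<xi> - \<eta>(X) \<xi> = 0. So \<phi> is parallel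
  along \<xi>.\<close>

lemma nab_\<xi>M_\<Phi>:
  assumes X: "X \<in> \<X>"
  shows "nab p (\<xi>M p) (\<Phi> X) = \<Phi> (cov nab \<xi>M X) p"
proof (rule di_eqD[where p = p])
  note \<Phi>X = \<Phi>_field[OF X] and t = vector_field_tangent[OF \<xi>M_field, of p]
    and diX = pushforward_section[OF X] and cX = cov_field[OF \<xi>M_field X]
  have gauss: "di (nab p (\<xi>M p) Y) = D p (\<xi>M p) (\<lambda>q. di (Y q))" if "Y \<in> \<X>" for Y
  proof -
    have "h \<xi>M Y p = 0" by (simp only: h_\<xi>M(2)[OF that] zero_fun_apply)
    then show ?thesis unfolding h_apply by simp
  qed
  have "g (i p) (di (\<xi>M p)) (di (X p)) = \<eta> (i p) (di (X p))"
    using g_sym[OF di_tangent[OF t] section_tangent[OF diX]] g_\<xi>[OF section_tangent[OF diX]]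
    by (simp add: di_\<xi>M)
  then show "di (nab p (\<xi>M p) (\<Phi> X)) = di (\<Phi> (cov nab \<xi>M X) p)"
    unfolding gauss[OF \<Phi>X] di_\<Phi>[OF X] D_\<phi>[OF t diX] di_\<Phi>[OF cX]
    unfolding cov_def gauss[OF X] di_\<xi>M by simp
  show "nab p (\<xi>M p) (\<Phi> X) \<in> tangent_space A p" "\<Phi> (cov nab \<xi>M X) p \<in> tangent_space A p"
    by (intro nab_tangent t \<Phi>X \<Phi>_tangent[OF cX])+
qed

lemma \<Phi>_combination:
  assumes "X \<in> \<X>" "Y \<in> \<X>" "U \<in> \<X>" and U: "U p = a *\<^sub>R X p + b *\<^sub>R Y p"
  shows "\<Phi> U p = a *\<^sub>R \<Phi> X p + b *\<^sub>R \<Phi> Y p"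
proof (rule di_eqD[where p = p])
  note t = section_tangent[OF pushforward_section[OF assms(1)], of p]
    section_tangent[OF pushforward_section[OF assms(2)], of p]
  show "di (\<Phi> U p) = di (a *\<^sub>R \<Phi> X p + b *\<^sub>R \<Phi> Y p)"
    unfolding di_\<Phi>[OF assms(3)] U differential_add differential_scale di_\<Phi>[OF assms(1)] di_\<Phi>[OF assms(2)]
    by (simp only: \<phi>_add \<phi>_scale t tangent_space_scale[OF B])
qed (intro \<Phi>_tangent assms(1-3) tangent_space_add[OF A] tangent_space_scale[OF A])+

text \<open>Everything follows from \<nabla>_X \<xi> = - c \<phi> X inside M: \<nabla>_\<xi> \<xi> =
  0, the product rule for - c \<phi> X produces \<xi>(c), and torsion-freeness rewrites [X, \<xi>]
  as - c \<phi> X - \<nabla>_\<xi> X. The two terms with \<phi>(\<nabla>_\<xi> X) cancel.\<close>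

lemma curvature_\<xi>M:
  assumes X: "X \<in> \<X>"
  shows "curvature nab X \<xi>M \<xi>M p = \<xi>M p c *\<^sub>R \<Phi> X p + - (c p)\<^sup>2 *\<^sub>R \<Phi> (\<Phi> X) p"
proof -
  note \<Phi>X = \<Phi>_field[OF X] and t = vector_field_tangent[OF \<xi>M_field, of p]
    and cX = cov_field[OF \<xi>M_field X] and L = lie_bracket_vector_field[OF A X \<xi>M_field]
  have "cov nab \<xi>M \<xi>M = 0"
    by (rule ext) (simp only: cov_def nab_\<xi>M[OF \<xi>M_field] \<Phi>_\<xi>M scaleR_zero_right zero_fun_apply)
  then have 1: "cov nab X (cov nab \<xi>M \<xi>M) p = 0"
    by (simp only: cov_def[of nab X] nab.D_zero[OF vector_field_tangent[OF X]])
  have "cov nab X \<xi>M = (\<lambda>q. (-1 * c q) *\<^sub>R \<Phi> X q)"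
    by (rule ext) (simp add: cov_def nab_\<xi>M[OF X])
  then have "cov nab \<xi>M (cov nab X \<xi>M) p = nab p (\<xi>M p) (\<lambda>q. (-1 * c q) *\<^sub>R \<Phi> X q)"
    by (simp only: cov_def[of nab \<xi>M])
  also have "\<dots> = \<xi>M p (\<lambda>q. -1 * c q) *\<^sub>R \<Phi> X p + (-1 * c p) *\<^sub>R nab p (\<xi>M p) (\<Phi> X)"
    by (intro nab.D_scale[OF t] smooth_functions_mult smooth_functions_const A c_smooth
        \<Phi>X[unfolded vector_fields_def])
  finally have 2: "cov nab \<xi>M (cov nab X \<xi>M) p = - \<xi>M p c *\<^sub>R \<Phi> X p - c p *\<^sub>R \<Phi> (cov nab \<xi>M X) p"
    using tangent_scale[OF t c_smooth, of "-1"] by (simp add: nab_\<xi>M_\<Phi>[OF X])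
  have lie: "lie_bracket X \<xi>M p = - c p *\<^sub>R \<Phi> X p + -1 *\<^sub>R cov nab \<xi>M X p"
    using nab_torsion_free[OF X \<xi>M_field, of p] by (simp add: nab_\<xi>M[OF X] cov_def)
  have 3: "cov nab (lie_bracket X \<xi>M) \<xi>M p = (c p)\<^sup>2 *\<^sub>R \<Phi> (\<Phi> X) p + c p *\<^sub>R \<Phi> (cov nab \<xi>M X) p"
    unfolding cov_def[of nab "lie_bracket X \<xi>M"] nab_\<xi>M[OF L] \<Phi>_combination[OF \<Phi>X cX L lie]
    by (simp add: scaleR_diff_right power2_eq_square)
  have "curvature nab X \<xi>M \<xi>M p = cov nab X (cov nab \<xi>M \<xi>M) p - cov nab \<xi>M (cov nab X \<xi>M) p
      - cov nab (lie_bracket X \<xi>M) \<xi>M p"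
    by (simp add: curvature_def)
  then show ?thesis
    unfolding 1 2 3 by (simp del: minus_apply plus_fun_apply)
qed

text \<open>With \<xi> in both last slots \<nabla>h vanishes identically, which removes the normal
  curvature term and the term with R(X, \<xi>)Z. In the other two, one slot is still \<xi>, so
  \<nabla>h reduces to - h(R(X, \<xi>)\<xi>, \<nabla>_Z \<xi>), up to the order of arguments;
  symmetry makes them equal.\<close>

lemma two_semiparallel_curvature:
  assumes sp: "two_semiparallel A B i g D nab" and X: "X \<in> \<X>" and Z: "Z \<in> \<X>"
  shows "h (curvature nab X \<xi>M \<xi>M) (cov nab Z \<xi>M) p = 0"
proof -
  let ?nabh = "cov_second_fundamental_form A B i g D nab"
  let ?R = "curvature nab X \<xi>M"
  note R = curvature_field[OF X \<xi>M_field] and \<xi> = \<xi>M_field and cZ = cov_field[OF Z \<xi>M_field]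
  have h0: "?nabh Z U \<xi>M = - h U (cov nab Z \<xi>M)" "?nabh Z \<xi>M U = - h (cov nab Z \<xi>M) U"
    if U: "U \<in> \<X>" for U
    unfolding cov_second_fundamental_form_def Let_def
    by (simp_all only: h_\<xi>M[OF U] h_\<xi>M[OF cov_field[OF Z U]] cov_normal_0[OF Z]) simp_all
  have "?nabh Z' \<xi>M \<xi>M = 0" if Z': "Z' \<in> \<X>" for Z'
    unfolding cov_second_fundamental_form_def Let_def
    by (simp only: h_\<xi>M[OF \<xi>] h_\<xi>M[OF cov_field[OF Z' \<xi>]] cov_normal_0[OF Z']) simp
  note h1 = this[OF Z] this[OF R[OF Z]]
  have "curvature N X \<xi>M (?nabh Z \<xi>M \<xi>M) - ?nabh (?R Z) \<xi>M \<xi>M - ?nabh Z (?R \<xi>M) \<xi>M - ?nabh Z \<xi>M (?R \<xi>M) = 0"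
    using sp X Z \<xi> unfolding two_semiparallel_def Let_def by blast
  then have "h (?R \<xi>M) (cov nab Z \<xi>M) + h (cov nab Z \<xi>M) (?R \<xi>M) = 0"
    unfolding h1 h0[OF R[OF \<xi>]] curvature_normal_0[OF X \<xi>]
    by (simp only: diff_self diff_0 minus_minus diff_minus_eq_add add_0_left)
  from fun_cong[OF this, of p] have "h (?R \<xi>M) (cov nab Z \<xi>M) p + h (cov nab Z \<xi>M) (?R \<xi>M) p = 0"
    by (simp only: plus_fun_apply zero_fun_apply)
  then have "2 *\<^sub>R h (?R \<xi>M) (cov nab Z \<xi>M) p = 0"
    unfolding h_sym[OF cZ R[OF \<xi>]] by (simp only: scaleR_2)
  then show ?thesis by (simp only: scaleR_eq_0_iff) simp
qed

lemma two_semiparallel_imp_totally_geodesic: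
  assumes sp: "two_semiparallel A B i g D nab"
  shows "totally_geodesic A B i D nab"
proof -
  have key: "h (\<Phi> X) (\<Phi> Z) p = 0" if X: "X \<in> \<X>" and Z: "Z \<in> \<X>" for X Z p
  proof -
    let ?a = "\<xi>M p c"
    note \<Phi>X = \<Phi>_field[OF X] and \<Phi>Z = \<Phi>_field[OF Z]
    \<comment> \<open>Stated for every Y because it is used for X and for \<open>\<Phi> X\<close>.
      In its proof a summand with coefficient 0 brings a plain multiple into the two-term shape of
      the combination lemmas, and the factor c is cancelled.\<close>
    have eq: "?a *\<^sub>R h (\<Phi> Y) (\<Phi> Z) p + - (c p)\<^sup>2 *\<^sub>R h (\<Phi> (\<Phi> Y)) (\<Phi> Z) p = 0" if Y: "Y \<in> \<X>" for Y
    proof -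
      note \<Phi>Y = \<Phi>_field[OF Y]
      note R = curvature_field[OF Y \<xi>M_field \<xi>M_field]
      have "cov nab Z \<xi>M p = - c p *\<^sub>R \<Phi> Z p + 0 *\<^sub>R \<Phi> Z p"
        by (simp add: cov_def nab_\<xi>M[OF Z])
      from h_combination_right[OF \<Phi>Z \<Phi>Z R cov_field[OF Z \<xi>M_field] this]
      have "- c p *\<^sub>R h (curvature nab Y \<xi>M \<xi>M) (\<Phi> Z) p = 0"
        using two_semiparallel_curvature[OF sp Y Z, of p] by simp
      then have "h (curvature nab Y \<xi>M \<xi>M) (\<Phi> Z) p = 0" using c_nonzero[of p] by simp
      then show ?thesis
        using h_combination_left[OF \<Phi>Y \<Phi>_field[OF \<Phi>Y] \<Phi>Z R curvature_\<xi>M[OF Y]] by metis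
    qed
    \<comment> \<open>The identity \<phi>^3 = - \<phi> closes the system: the equation for
      \<open>\<Phi> X\<close> brings in no third unknown.\<close>
    have "\<Phi> (\<Phi> (\<Phi> X)) p = (- 1) *\<^sub>R \<Phi> X p + 0 *\<^sub>R \<Phi> X p" by (simp add: \<Phi>_\<Phi>_\<Phi>[OF X])
    from h_combination_left[OF \<Phi>X \<Phi>X \<Phi>Z \<Phi>_field[OF \<Phi>_field[OF \<Phi>X]] this]
    have h3: "h (\<Phi> (\<Phi> (\<Phi> X))) (\<Phi> Z) p = - h (\<Phi> X) (\<Phi> Z) p" by simp
    define u w where "u = h (\<Phi> X) (\<Phi> Z) p" and "w = h (\<Phi> (\<Phi> X)) (\<Phi> Z) p"
    have uw: "?a *\<^sub>R u = (c p)\<^sup>2 *\<^sub>R w" "?a *\<^sub>R w = - ((c p)\<^sup>2 *\<^sub>R u)"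
      using eq[OF X] eq[OF \<Phi>X] unfolding h3 u_def[symmetric] w_def[symmetric]
      by (simp_all add: add_eq_0_iff2)
    \<comment> \<open>Elimination of \<open>w\<close>: with a = \<xi>(c), a^2 u = c^2 a w = - c^4
      u.\<close>
    have "(?a * ?a) *\<^sub>R u = ?a *\<^sub>R ((c p)\<^sup>2 *\<^sub>R w)"
      by (simp only: scaleR_scaleR[symmetric] uw(1))
    also have "\<dots> = (c p)\<^sup>2 *\<^sub>R (?a *\<^sub>R w)" by (rule scaleR_left_commute)
    finally have "(?a * ?a + (c p)\<^sup>2 * (c p)\<^sup>2) *\<^sub>R u = 0"
      unfolding uw(2) by (simp add: scaleR_add_left)
    moreover have "?a * ?a + (c p)\<^sup>2 * (c p)\<^sup>2 > 0"
      using c_nonzero[of p] by (simp add: add_nonneg_pos)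
    ultimately have "u = 0" by simp
    then show ?thesis by (simp only: u_def)
  qed
  have "h X Y p = 0" if X: "X \<in> \<X>" and Y: "Y \<in> \<X>" for X Y p
  proof -
    note \<Phi>X = \<Phi>_field[OF X] and \<Phi>Y = \<Phi>_field[OF Y]
    note \<Phi>\<Phi>X = \<Phi>_field[OF \<Phi>X] and \<Phi>\<Phi>Y = \<Phi>_field[OF \<Phi>Y]
    have \<xi>0: "h \<xi>M U p = 0" "h U \<xi>M p = 0" if "U \<in> \<X>" for U
      by (simp_all only: h_\<xi>M[OF that] zero_fun_apply)
    \<comment> \<open>By \<phi>^2 X = - X + \<eta>(X) \<xi>, a vector differs from - \<phi>^2 X by a
      multiple of \<xi>, on which \<open>h\<close> vanishes. So \<open>key\<close> for
      \<open>\<Phi> X\<close> and \<open>\<Phi> Y\<close> frees first the left slot, then the right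
      one.\<close>
    have "h X (\<Phi> (\<Phi> Y)) p = 0"
      using h_combination_left[OF X \<xi>M_field \<Phi>\<Phi>Y \<Phi>\<Phi>X \<Phi>_\<Phi>[OF X]] key[OF \<Phi>X \<Phi>Y, of p] \<xi>0(1)[OF \<Phi>\<Phi>Y]
      by simp
    then show ?thesis
      using h_combination_right[OF Y \<xi>M_field X \<Phi>\<Phi>Y \<Phi>_\<Phi>[OF Y]] \<xi>0(2)[OF X] by simp
  qed
  then show ?thesis by (auto simp: totally_geodesic_def fun_eq_iff)
qed

end

theorem corollary3p6:
  fixes B :: "('a::{t2_space,second_countable_topology}, 'e::euclidean_space) atlas"
    and A :: "('b::{t2_space,second_countable_topology}, 'f::euclidean_space) atlas"
    and i :: "'b \<Rightarrow> 'a"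
    and g :: "'a metric"
    and \<phi> :: "'a \<Rightarrow> 'a tvec \<Rightarrow> 'a tvec"
    and \<xi> :: "'a \<Rightarrow> 'a tvec"
    and \<eta> :: "'a \<Rightarrow> 'a tvec \<Rightarrow> real"
    and f1 f2 f3 :: "'a \<Rightarrow> real"
    and nabbar :: "('a, 'a tvec) connection"
    and D :: "('b, 'a tvec) connection"
    and nab :: "('b, 'b tvec) connection"
    and n :: nat
  assumes "generalized_sasakian_space_form n B g \<phi> \<xi> \<eta> f1 f2 f3 nabbar"
    and "structure_equations B g \<phi> \<xi> \<eta> f1 f3 nabbar"
    and "\<And>x. f1 x \<noteq> f3 x"
    and "invariant_submanifold A B i \<phi> \<xi>"
    and "pullback_connection A B i nabbar D"
    and "levi_civita A (induced_metric B i g) nab"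
  shows "totally_geodesic A B i D nab \<longleftrightarrow> two_semiparallel A B i g D nab"
proof -
  have space: "smooth_atlas B" "almost_contact_metric B g \<phi> \<xi> \<eta>" "f1 \<in> smooth_functions B"
    "f3 \<in> smooth_functions B" "levi_civita B g nabbar"
    using assms(1) unfolding generalized_sasakian_space_form_def by blast+
  have metric: "riemannian_metric B g" using space(2) unfolding almost_contact_metric_def by blast
  have sub: "smooth_atlas A" "smooth_map A B i" "\<And>p. inj_on (differential B i) (tangent_space A p)"
    "\<And>p. \<xi> (i p) \<in> differential B i ` tangent_space A p"
    "\<And>p u. u \<in> tangent_space A p \<Longrightarrow> \<phi> (i p) (differential B i u) \<in> differential B i ` tangent_space A p"
    using assms(4) unfolding invariant_submanifold_def immersion_def by blast+
  interpret invariant_submanifold_setting A B i nabbar D g nab \<phi> \<xi> \<eta> f1 f3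
    by unfold_locales (fact space metric sub assms(2,3,5,6))+
  show ?thesis
    using totally_geodesic_imp_two_semiparallel two_semiparallel_imp_totally_geodesic by blast
qed

end
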